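(* In the setting of the energy-aware active information acquisition problem defined in the context (robots $\mathcal{R}=\{1,\dots,n\}$, ground set $\mathcal{M}=\bigcup_{i=1}^n\mathcal{M}_i$ of $N=|\mathcal{M}|$ control trajectories, admissible family $\mathcal{I}$, objective $J(S)=\mathbb{I}(y_{1:T};z_{S,1:T})-C(S)$, weights $r_i\ge 0$ and energy bound $c^{\max}$), add a constant offset to the objective so as to make it non-negative, and consider $$\max_{S\in\mathcal{I}}\ g(S):=J(S)+O,\qquad O:=\sum_{i=1}^n r_i\,c^{\max}.$$ Let $\alpha>0$, let $S^*$ be an optimal solution of this problem, and let $S^{\mathrm{ls}}$ be a solution obtained by the algorithm CLS (Centralized Local Search, specified in the context) run with parameter $\alpha$, ground set $\mathcal{M}$, admissible family $\mathcal{I}$ and oracle $g$. Then $$0\ \le\ g(S^* )\ \le\ 4(1+\alpha)\,g(S^{\mathrm{ls}}).$$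
   Context: **Robots and trajectories.** Robots are indexed by $i\in\mathcal{R}=\{1,\dots,n\}$. Robot $i$ has state $x_{i,t}\in\mathcal{X}_i$ at times $t=0,\dots,T$, with known initial state $x_{i,0}$ and deterministic dynamics $x_{i,t+1}=f_i(x_{i,t},u_{i,t})$, where $u_{i,t}\in\mathcal{U}_i$ and $\mathcal{U}_i$ is a finite set. A control trajectory is a sequence $\sigma_i=(u_{i,0},\dots,u_{i,T-1})\in\mathcal{U}_i^T$. Robot $i$ has a finite set $\mathcal{M}_i=\{\sigma_i^k\}_{k=1}^{N_i}$ of available control trajectories. Trajectories of different robots are regarded as distinct elements, so that the $\mathcal{M}_i$ are pairwise disjoint. Let $\mathcal{M}=\bigcup_{i=1}^n\mathcal{M}_i$, $N=|\mathcal{M}|$, and $$\mathcal{I}=\{S\subseteq\mathcal{M} : |S\cap\mathcal{M}_i|\le 1\ \ \forall i\in\mathcal{R}\}$$ (the independent sets of a partition matroid). For $S\in\mathcal{I}$, let $\mathcal{R}_S=\{i\in\mathcal{R}: |\mathcal{M}_i\cap S|=1\}$ be the set of robots assigned a trajectory. Each $i\in\mathcal{R}_S$ follows its trajectory in $S$, which determines its states $x_{i,1},\dots,x_{i,T}$. **Target and sensors.** The target state $y_t\in\mathbb{R}^{d_y}$ evolves as $y_{t+1}=A_ty_t+w_t$, $w_t\sim\mathcal{N}(0,W_t)$, $W_t\succeq 0$, with a given Gaussian prior on $y_0$ having covariance $\Sigma_0$. Robot $i$ in state $x_{i,t}$ takes the measurement $z_{i,t}=H_{i,t}(x_{i,t})y_t+v_{i,t}(x_{i,t})\in\mathbb{R}^{d_{z_i}}$,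 $v_{i,t}(x_{i,t})\sim\mathcal{N}(0,V_{i,t}(x_{i,t}))$. The measurement noises are independent at any pair of times and across sensors. As usual for the Kalman filter, the process noises are independent over time, and the prior, process noises and measurement noises are mutually independent. $z_{S,1:T}$ denotes all measurements at times $1,\dots,T$ collected by robots in $\mathcal{R}_S$ following the trajectories in $S$. **Mutual information.** Let $\rho^{\mathrm p}_t(\Sigma)=A_t\Sigma A_t^\top+W_t$ and $$\rho^{\mathrm e}_{S,t}(\Sigma,x_{S,t})=\Big(\Sigma^{-1}+\sum_{i\in\mathcal{R}_S}M_{i,t}(x_{i,t})\Big)^{-1},\qquad M_{i,t}(x)=H_{i,t}(x)^\top V_{i,t}(x)^{-1}H_{i,t}(x),$$ (all inverses appearing are assumed to exist), where $x_{S,t}$ is the joint state of the robots in $\mathcal{R}_S$. The target estimate covariance is $\Sigma_{S,0}=\Sigma_0$, $\Sigma_{S,t+1}=\rho^{\mathrm e}_{S,t+1}(\rho^{\mathrm p}_t(\Sigma_{S,t}),x_{S,t+1})$. The mutual information between target states and observations is $$\mathbb{I}(y_{1:T};z_{S,1:T})=\tfrac12\sum_{t=1}^T\big[\log\det\big(\rho^{\mathrm p}_{t-1}(\Sigma_{S,t-1})\big)-\log\det(\Sigma_{S,t})\big]\ \ge 0 .$$ **Energy cost and problem.** $C(S)=\sum_{\sigma_i\in S}r_i\,C_i(\sigma_i)$, where $r_i\ge0$ and $0\le C_i(\cdot)\le c^{\max}$ for every robot $i$. The energy-aware active information acquisition problem is, for a finite horizon $T$, to maximize $J(S)=\mathbb{I}(y_{1:T};z_{S,1:T})-C(S)$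 over $S\in\mathcal{I}$. **Algorithm CLS (Centralized Local Search).** Input: $\alpha>0$, ground set $\mathcal{M}$, family $\mathcal{I}$, oracle $g$. Set $N\leftarrow|\mathcal{M}|$ (fixed from here on) and $S_1,S_2\leftarrow\emptyset$. For $k=1,2$ in turn: 1. Set $S_k\leftarrow\{a\}$ where $a\in\mathcal{M}$ maximizes $g(\{a\})$ (if the current $\mathcal{M}$ is empty, $S_k=\emptyset$). 2. While some set $S_k'$ resulting from one of the following operations satisfies $S_k'\in\mathcal{I}$ and $g(S_k')\ge\left(1+\frac{\alpha}{N^4}\right)g(S_k)$, set $S_k\leftarrow S_k'$: - Delete: $S_k'=S_k\setminus\{d\}$, with $d\in S_k$; - Add: $S_k'=S_k\cup\{a\}$, with $a\in\mathcal{M}\setminus S_k$; - Swap: $S_k'=(S_k\setminus\{d\})\cup\{a\}$, with $d\in S_k$, $a\in\mathcal{M}\setminus S_k$. 3. When no such operation exists, set $\mathcal{M}\leftarrow\mathcal{M}\setminus S_k$. Output: whichever of $S_1,S_2$ has the larger value of $g$. The choices among several available operations or maximizers are arbitrary. *)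

theory Defs
  imports
    Complex_Main
    "Jordan_Normal_Form.Determinant"
    "Jordan_Normal_Form.Gauss_Jordan_Elimination"
begin

section \<open>Matrices\<close>

text \<open>Matrices carry their dimensions as data, because the measurement dimension differs from
  robot to robot.\<close>

definition mat_inv :: "real mat \<Rightarrow> real mat" where
  "mat_inv A = the (mat_inverse A)"

definition psd_mat :: "nat \<Rightarrow> real mat \<Rightarrow> bool" where
  "psd_mat m A \<longleftrightarrow> A \<in> carrier_mat m m \<and> transpose_mat A = A \<and>
     (\<forall>v\<in>carrier_vec m. 0 \<le> v \<bullet> (A *\<^sub>v v))"

definition mat_sum :: "nat \<Rightarrow> nat \<Rightarrow> ('i \<Rightarrow> real mat) \<Rightarrow> 'i set \<Rightarrow> real mat" where
  "mat_sum nr nc F I = mat nr nc (\<lambda>(p, q). \<Sum>i\<in>I. F i $$ (p, q))"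


section \<open>Energy-aware active information acquisition\<close>

text \<open>The types \<open>'x\<close> and \<open>'u\<close> are common to all robots; each robot has its own state
  space and control set inside them. The target and sensor model is given by its matrices
  \<open>A\<^sub>t\<close>, \<open>W\<^sub>t\<close>, \<open>\<Sigma>\<^sub>0\<close>, \<open>H\<^sub>i\<^sub>,\<^sub>t(x)\<close>, \<open>V\<^sub>i\<^sub>,\<^sub>t(x)\<close>, on which the mutual information of
  the linear Gaussian model depends.\<close>

record ('x, 'u) aia =
  num_robots :: nat
  horizon :: nat
  state_space :: "nat \<Rightarrow> 'x set"
  init_state :: "nat \<Rightarrow> 'x"
  control_set :: "nat \<Rightarrow> 'u set"
  dynamics :: "nat \<Rightarrow> 'x \<Rightarrow> 'u \<Rightarrow> 'x"
  trajs :: "nat \<Rightarrow> 'u list set"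
  target_dim :: nat
  sensor_dim :: "nat \<Rightarrow> nat"
  target_map :: "nat \<Rightarrow> real mat"
  process_cov :: "nat \<Rightarrow> real mat"
  prior_cov :: "real mat"
  sensor_map :: "nat \<Rightarrow> nat \<Rightarrow> 'x \<Rightarrow> real mat"
  sensor_cov :: "nat \<Rightarrow> nat \<Rightarrow> 'x \<Rightarrow> real mat"
  cost_weight :: "nat \<Rightarrow> real"
  energy :: "nat \<Rightarrow> 'u list \<Rightarrow> real"
  energy_max :: real

definition robots :: "('x, 'u) aia \<Rightarrow> nat set" where
  "robots P = {1..num_robots P}"

text \<open>Tagging a control sequence with its robot makes the trajectory sets of different robots
  disjoint.\<close>

definition robot_trajs :: "('x, 'u) aia \<Rightarrow> nat \<Rightarrow> (nat \<times> 'u list) set" where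
  "robot_trajs P i = {i} \<times> trajs P i"

definition ground :: "('x, 'u) aia \<Rightarrow> (nat \<times> 'u list) set" where
  "ground P = (\<Union>i\<in>robots P. robot_trajs P i)"

definition indep :: "('x, 'u) aia \<Rightarrow> (nat \<times> 'u list) set set" where
  "indep P = {S. S \<subseteq> ground P \<and> (\<forall>i\<in>robots P. card (S \<inter> robot_trajs P i) \<le> 1)}"

definition assigned :: "('x, 'u) aia \<Rightarrow> (nat \<times> 'u list) set \<Rightarrow> nat set" where
  "assigned P S = {i \<in> robots P. card (robot_trajs P i \<inter> S) = 1}"

primrec state_along :: "('x, 'u) aia \<Rightarrow> nat \<Rightarrow> 'u list \<Rightarrow> nat \<Rightarrow> 'x" where
  "state_along P i \<sigma> 0 = init_state P i"
| "state_along P i \<sigma> (Suc t) = dynamics P i (state_along P i \<sigma> t) (\<sigma> ! t)"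

text \<open>Meaningful only for robots in \<^term>\<open>assigned P S\<close>.\<close>

definition robot_state :: "('x, 'u) aia \<Rightarrow> (nat \<times> 'u list) set \<Rightarrow> nat \<Rightarrow> nat \<Rightarrow> 'x" where
  "robot_state P S i t = state_along P i (THE \<sigma>. (i, \<sigma>) \<in> robot_trajs P i \<inter> S) t"

definition sensor_info :: "('x, 'u) aia \<Rightarrow> nat \<Rightarrow> nat \<Rightarrow> 'x \<Rightarrow> real mat" where
  "sensor_info P i t x =
     transpose_mat (sensor_map P i t x) * mat_inv (sensor_cov P i t x) * sensor_map P i t x"

definition kf_predict :: "('x, 'u) aia \<Rightarrow> nat \<Rightarrow> real mat \<Rightarrow> real mat" where
  "kf_predict P t \<Sigma> =
     target_map P t * \<Sigma> * transpose_mat (target_map P t) + process_cov P t"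

definition posterior_info ::
  "('x, 'u) aia \<Rightarrow> (nat \<times> 'u list) set \<Rightarrow> nat \<Rightarrow> real mat \<Rightarrow> real mat" where
  "posterior_info P S t \<Sigma> = mat_inv \<Sigma> +
     mat_sum (target_dim P) (target_dim P)
       (\<lambda>i. sensor_info P i t (robot_state P S i t)) (assigned P S)"

definition kf_update ::
  "('x, 'u) aia \<Rightarrow> (nat \<times> 'u list) set \<Rightarrow> nat \<Rightarrow> real mat \<Rightarrow> real mat" where
  "kf_update P S t \<Sigma> = mat_inv (posterior_info P S t \<Sigma>)"

primrec est_cov :: "('x, 'u) aia \<Rightarrow> (nat \<times> 'u list) set \<Rightarrow> nat \<Rightarrow> real mat" where
  "est_cov P S 0 = prior_cov P"
| "est_cov P S (Suc t) = kf_update P S (Suc t) (kf_predict P t (est_cov P S t))"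

definition mutual_info :: "('x, 'u) aia \<Rightarrow> (nat \<times> 'u list) set \<Rightarrow> real" where
  "mutual_info P S = 1/2 * (\<Sum>t = 1..horizon P.
     ln (det (kf_predict P (t - 1) (est_cov P S (t - 1)))) - ln (det (est_cov P S t)))"

definition energy_cost :: "('x, 'u) aia \<Rightarrow> (nat \<times> 'u list) set \<Rightarrow> real" where
  "energy_cost P S = (\<Sum>(i, \<sigma>)\<in>S. cost_weight P i * energy P i \<sigma>)"

definition objective :: "('x, 'u) aia \<Rightarrow> (nat \<times> 'u list) set \<Rightarrow> real" where
  "objective P S = mutual_info P S - energy_cost P S"

definition offset :: "('x, 'u) aia \<Rightarrow> real" where
  "offset P = (\<Sum>i\<in>robots P. cost_weight P i * energy_max P)"

definition offset_objective :: "('x, 'u) aia \<Rightarrow> (nat \<times> 'u list) set \<Rightarrow> real" where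
  "offset_objective P S = objective P S + offset P"

text \<open>The standing assumptions. Sensor covariances have to be invertible only at the states
  that the available trajectories reach, since only there does the inverse occur in the
  objective. \<^prop>\<open>0 \<le> energy_max P\<close> follows from the other energy bounds as soon as some
  robot has a trajectory.\<close>

definition valid_robots :: "('x, 'u) aia \<Rightarrow> bool" where
  "valid_robots P \<longleftrightarrow> (\<forall>i\<in>robots P.
     finite (control_set P i) \<and>
     init_state P i \<in> state_space P i \<and>
     (\<forall>x\<in>state_space P i. \<forall>u\<in>control_set P i. dynamics P i x u \<in> state_space P i) \<and>
     finite (trajs P i) \<and>
     (\<forall>\<sigma>\<in>trajs P i. length \<sigma> = horizon P \<and> set \<sigma> \<subseteq> control_set P i))"

definition valid_target :: "('x, 'u) aia \<Rightarrow> bool" where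
  "valid_target P \<longleftrightarrow>
     psd_mat (target_dim P) (prior_cov P) \<and>
     (\<forall>t<horizon P. target_map P t \<in> carrier_mat (target_dim P) (target_dim P) \<and>
                    psd_mat (target_dim P) (process_cov P t))"

definition valid_sensors :: "('x, 'u) aia \<Rightarrow> bool" where
  "valid_sensors P \<longleftrightarrow> (\<forall>i\<in>robots P. \<forall>t\<in>{1..horizon P}.
     (\<forall>x\<in>state_space P i.
        sensor_map P i t x \<in> carrier_mat (sensor_dim P i) (target_dim P) \<and>
        psd_mat (sensor_dim P i) (sensor_cov P i t x)) \<and>
     (\<forall>\<sigma>\<in>trajs P i. invertible_mat (sensor_cov P i t (state_along P i \<sigma> t))))"

definition kf_inverses_exist :: "('x, 'u) aia \<Rightarrow> bool" where
  "kf_inverses_exist P \<longleftrightarrow> (\<forall>S\<in>indep P. \<forall>t<horizon P.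
     invertible_mat (kf_predict P t (est_cov P S t)) \<and>
     invertible_mat (posterior_info P S (Suc t) (kf_predict P t (est_cov P S t))))"

definition valid_energy :: "('x, 'u) aia \<Rightarrow> bool" where
  "valid_energy P \<longleftrightarrow> 0 \<le> energy_max P \<and>
     (\<forall>i\<in>robots P. 0 \<le> cost_weight P i \<and>
        (\<forall>\<sigma>\<in>trajs P i. 0 \<le> energy P i \<sigma> \<and> energy P i \<sigma> \<le> energy_max P))"

definition aia_problem :: "('x, 'u) aia \<Rightarrow> bool" where
  "aia_problem P \<longleftrightarrow> valid_robots P \<and> valid_target P \<and> valid_sensors P \<and>
     kf_inverses_exist P \<and> valid_energy P"


section \<open>Centralized local search\<close>

definition ls_moves :: "'a set \<Rightarrow> 'a set \<Rightarrow> 'a set set" where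
  "ls_moves M S =
     {S - {d} | d. d \<in> S} \<union>
     {S \<union> {a} | a. a \<in> M - S} \<union>
     {(S - {d}) \<union> {a} | d a. d \<in> S \<and> a \<in> M - S}"

text \<open>The number \<open>N\<close> is a separate argument: it stays the size of the original ground set when
  \<open>M\<close> shrinks.\<close>

definition ls_step ::
  "real \<Rightarrow> nat \<Rightarrow> 'a set set \<Rightarrow> ('a set \<Rightarrow> real) \<Rightarrow> 'a set \<Rightarrow> 'a set \<Rightarrow> 'a set \<Rightarrow> bool" where
  "ls_step \<alpha> N \<I> g M S S' \<longleftrightarrow>
     S' \<in> ls_moves M S \<and> S' \<in> \<I> \<and> g S' \<ge> (1 + \<alpha> / real N ^ 4) * g S"

definition ls_init :: "('a set \<Rightarrow> real) \<Rightarrow> 'a set \<Rightarrow> 'a set \<Rightarrow> bool" where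
  "ls_init g M S \<longleftrightarrow>
     (if M = {} then S = {}
      else \<exists>a. S = {a} \<and> is_arg_max (\<lambda>b. g {b}) (\<lambda>b. b \<in> M) a)"

definition ls_result ::
  "real \<Rightarrow> nat \<Rightarrow> 'a set set \<Rightarrow> ('a set \<Rightarrow> real) \<Rightarrow> 'a set \<Rightarrow> 'a set \<Rightarrow> bool" where
  "ls_result \<alpha> N \<I> g M S \<longleftrightarrow>
     (\<exists>S0. ls_init g M S0 \<and> (ls_step \<alpha> N \<I> g M)\<^sup>*\<^sup>* S0 S) \<and>
     (\<nexists>S'. ls_step \<alpha> N \<I> g M S S')"

text \<open>The possible outputs of terminating runs, over all choices of maximizers and operations.\<close>

definition cls_output ::
  "real \<Rightarrow> 'a set \<Rightarrow> 'a set set \<Rightarrow> ('a set \<Rightarrow> real) \<Rightarrow> 'a set \<Rightarrow> bool" where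
  "cls_output \<alpha> M \<I> g S \<longleftrightarrow>
     (\<exists>S1 S2. ls_result \<alpha> (card M) \<I> g M S1 \<and>
              ls_result \<alpha> (card M) \<I> g (M - S1) S2 \<and>
              (S = S1 \<or> S = S2) \<and> g S = max (g S1) (g S2))"

end

theory Submission
  imports Defs
begin

text \<open>Write the target trajectory as \<open>y\<^sub>t = L\<^sub>t \<xi>\<close> with \<open>\<xi>\<close> standard Gaussian, where \<open>L\<^sub>t\<close> is built from the
  target maps and from factors \<open>B B\<^sup>T\<close> of the possibly singular covariances. With \<open>M\<^sub>S\<^sub>,\<^sub>t\<close> the summed
  sensor information of \<open>S\<close> at time \<open>t\<close>, the Kalman recursion telescopes to
  \<open>1/2 ln det (I + \<Sum>\<^sub>t L\<^sub>t\<^sup>T M\<^sub>S\<^sub>,\<^sub>t L\<^sub>t)\<close>. This formula makes sense for arbitrary sets \<open>S\<close> of trajectories, and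
  it is monotone and submodular because adding a rank-one term \<open>c c\<^sup>T\<close> multiplies \<open>det X\<close> by
  \<open>1 + c\<^sup>T X\<^sup>-\<^sup>1 c\<close>, which decreases as \<open>X\<close> grows.

  Only the first local optimum \<open>S\<close> is needed. For each robot, compare \<open>S\<close> with the set obtained by
  giving that robot its assignment in the optimal solution; this is an addition, deletion or swap.
  The sum of these comparisons over the robots that have a trajectory bounds the optimum by
  \<open>2 F(S) - C(S) + O\<close> up to the threshold error, where \<open>F\<close> is the information part, and \<open>C(S) \<le> O\<close>
  turns this into \<open>2 g(S)\<close>. So the factor is in fact at most \<open>2 + \<alpha>\<close>.\<close>

section \<open>Determinants and inverses\<close>

lemma det_one_plus_mult_comm:
  fixes A B :: "'a :: idom mat"
  assumes A: "A \<in> carrier_mat n m" and B: "B \<in> carrier_mat m n"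
  shows "det (1\<^sub>m n + A * B) = det (1\<^sub>m m + B * A)"
proof -
  define U where "U = four_block_mat (1\<^sub>m n) A (0\<^sub>m m n) (1\<^sub>m m)"
  define V where "V = four_block_mat (1\<^sub>m n + A * B) (0\<^sub>m n m) (- B) (1\<^sub>m m)"
  define V' where "V' = four_block_mat (1\<^sub>m n) (0\<^sub>m n m) (- B) (1\<^sub>m m + B * A)"
  have AB: "1\<^sub>m n + A * B \<in> carrier_mat n n" and BA: "1\<^sub>m m + B * A \<in> carrier_mat m m"
    and mB: "- B \<in> carrier_mat m n"
    using A B by auto
  have U: "U \<in> carrier_mat (n + m) (n + m)" unfolding U_def by simp
  have V: "V \<in> carrier_mat (n + m) (n + m)" unfolding V_def using AB by simp
  have V': "V' \<in> carrier_mat (n + m) (n + m)" unfolding V'_def using BA by simp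
  have nAB: "A * - B = - (A * B)" and nBA: "- B * A = - (B * A)"
    using A B by auto
  have 1: "U * four_block_mat (1\<^sub>m n + A * B) (0\<^sub>m n m) (- B) (1\<^sub>m m)
      = four_block_mat (1\<^sub>m n) A (- B) (1\<^sub>m m)"
    unfolding U_def
    by (subst mult_four_block_mat[OF one_carrier_mat A zero_carrier_mat one_carrier_mat AB zero_carrier_mat mB one_carrier_mat])
      (rule cong_four_block_mat, insert A B nAB, auto intro!: eq_matI)
  have 2: "V' * U = four_block_mat (1\<^sub>m n) A (- B) (1\<^sub>m m)"
    unfolding U_def V'_def
    by (subst mult_four_block_mat[OF one_carrier_mat zero_carrier_mat mB BA one_carrier_mat A zero_carrier_mat one_carrier_mat])
      (rule cong_four_block_mat, insert A B nBA, auto intro!: eq_matI)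
  have "det U = 1" unfolding U_def
    by (subst det_four_block_mat_lower_left_zero[OF one_carrier_mat A refl one_carrier_mat]) simp
  moreover have "det V = det (1\<^sub>m n + A * B)" unfolding V_def
    by (subst det_four_block_mat_upper_right_zero[OF AB refl mB one_carrier_mat]) simp
  moreover have "det V' = det (1\<^sub>m m + B * A)" unfolding V'_def
    by (subst det_four_block_mat_upper_right_zero[OF one_carrier_mat refl mB BA]) simp
  moreover have "U * V = V' * U" using 1 2 by (simp add: V_def)
  then have "det U * det V = det V' * det U"
    using det_mult[OF U V] det_mult[OF V' U] by metis
  ultimately show ?thesis by simp
qed

lemma mat_inv_unique:
  assumes A: "A \<in> carrier_mat n n" and B: "B \<in> carrier_mat n n" and AB: "A * B = 1\<^sub>m n"
  shows "mat_inv A = B"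
proof -
  have BA: "B * A = 1\<^sub>m n" by (rule mat_mult_left_right_inverse[OF A B AB])
  have "A \<in> Units (ring_mat TYPE(real) n ())"
    unfolding Units_def using A B AB BA by (auto simp: ring_mat_def)
  with mat_inverse(1)[OF A, where b = "()"] obtain C where C: "mat_inverse A = Some C"
    by (cases "mat_inverse A") auto
  from mat_inverse(2)[OF A C] have CA: "C * A = 1\<^sub>m n" and Cc: "C \<in> carrier_mat n n" by auto
  have "C = C * (A * B)" using AB Cc by simp
  also have "\<dots> = B" using assoc_mult_mat[OF Cc A B] CA B by simp
  finally show ?thesis by (simp add: mat_inv_def C)
qed

lemma mat_inv_det_nonzero:
  assumes A: "A \<in> carrier_mat n n" and "det A \<noteq> 0"
  shows "mat_inv A \<in> carrier_mat n n" "A * mat_inv A = 1\<^sub>m n" "mat_inv A * A = 1\<^sub>m n"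
proof -
  from det_non_zero_imp_unit[OF A assms(2), of "()"] mat_inverse(1)[OF A, where b = "()"]
  obtain C where C: "mat_inverse A = Some C" by (cases "mat_inverse A") auto
  from mat_inverse(2)[OF A C] show "mat_inv A \<in> carrier_mat n n" "A * mat_inv A = 1\<^sub>m n"
    "mat_inv A * A = 1\<^sub>m n" by (auto simp: mat_inv_def C)
qed

lemma invertible_det_nonzero:
  fixes A :: "'a :: field mat"
  assumes A: "A \<in> carrier_mat n n" and "invertible_mat A"
  shows "det A \<noteq> 0"
proof -
  from assms obtain B where B: "inverts_mat A B" "inverts_mat B A"
    unfolding invertible_mat_def by auto
  then have AB: "A * B = 1\<^sub>m n" and BA: "B * A = 1\<^sub>m (dim_row B)"
    using A unfolding inverts_mat_def by auto
  have "dim_col B = n" using arg_cong[OF AB, of dim_col] by simp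
  moreover have "dim_row B = n" using arg_cong[OF BA, of dim_col] A by simp
  ultimately have Bc: "B \<in> carrier_mat n n" by auto
  have "det A * det B = 1" using det_mult[OF A Bc] AB by simp
  then show ?thesis by auto
qed

lemma mat_inv_sym:
  assumes A: "A \<in> carrier_mat n n" and "det A \<noteq> 0" and sym: "transpose_mat A = A"
  shows "transpose_mat (mat_inv A) = mat_inv A"
proof -
  note inv = mat_inv_det_nonzero[OF assms(1,2)]
  have "A * transpose_mat (mat_inv A) = transpose_mat (mat_inv A * A)"
    using transpose_mult[OF inv(1) A] sym by simp
  also have "\<dots> = 1\<^sub>m n" using inv(3) by simp
  finally show ?thesis using mat_inv_unique[OF A, of "transpose_mat (mat_inv A)"] inv(1) by simp
qed

section \<open>Positive semidefinite matrices\<close>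

lemma psd_matD:
  assumes "psd_mat n A"
  shows "A \<in> carrier_mat n n" "transpose_mat A = A" "v \<in> carrier_vec n \<Longrightarrow> 0 \<le> v \<bullet> (A *\<^sub>v v)"
  using assms by (auto simp: psd_mat_def)

lemma psd_mat_zero: "psd_mat n (0\<^sub>m n n)"
proof -
  have "0\<^sub>m n n *\<^sub>v v = 0\<^sub>v n" if "v \<in> carrier_vec n" for v :: "real vec"
    using that by (intro eq_vecI) auto
  then show ?thesis by (auto simp: psd_mat_def)
qed

lemma psd_mat_add:
  assumes "psd_mat n A" "psd_mat n B"
  shows "psd_mat n (A + B)"
proof -
  have "0 \<le> v \<bullet> ((A + B) *\<^sub>v v)" if v: "v \<in> carrier_vec n" for v
    using psd_matD[OF assms(1)] psd_matD[OF assms(2)] v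
    by (simp add: add_mult_distrib_mat_vec[where nr = n and nc = n] scalar_prod_add_distrib[where n = n])
  then show ?thesis using psd_matD[OF assms(1)] psd_matD[OF assms(2)]
    by (auto simp: psd_mat_def transpose_add[where nr = n and nc = n])
qed

lemma psd_mat_congruence:
  assumes "psd_mat n A" and L: "L \<in> carrier_mat n m"
  shows "psd_mat m (transpose_mat L * A * L)"
proof -
  note A = psd_matD[OF assms(1)]
  have AL: "A * L \<in> carrier_mat n m" and LA: "transpose_mat L * A \<in> carrier_mat m n" using A L by auto
  have "transpose_mat (transpose_mat L * A * L) = transpose_mat L * (A * L)"
    using transpose_mult[OF LA L] transpose_mult[of "transpose_mat L" m n A n] A L by simp
  then have "transpose_mat (transpose_mat L * A * L) = transpose_mat L * A * L"
    using assoc_mult_mat[of "transpose_mat L" m n A n L m] A L by simp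
  moreover have "0 \<le> v \<bullet> (transpose_mat L * A * L *\<^sub>v v)" if v: "v \<in> carrier_vec m" for v
  proof -
    have "transpose_mat L * A * L *\<^sub>v v = transpose_mat L *\<^sub>v (A *\<^sub>v (L *\<^sub>v v))"
      using assoc_mult_mat_vec[OF LA L v] assoc_mult_mat_vec[of "transpose_mat L" m n A n "L *\<^sub>v v"] A L v
      by simp
    then have "v \<bullet> (transpose_mat L * A * L *\<^sub>v v) = (L *\<^sub>v v) \<bullet> (A *\<^sub>v (L *\<^sub>v v))"
      using transpose_vec_mult_scalar[OF L v, of "A *\<^sub>v (L *\<^sub>v v)"] A L v 
        comm_scalar_prod[of v m "transpose_mat L *\<^sub>v (A *\<^sub>v (L *\<^sub>v v))"]
        comm_scalar_prod[of "L *\<^sub>v v" n "A *\<^sub>v (L *\<^sub>v v)"]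
      by simp
    then show ?thesis using A(3)[of "L *\<^sub>v v"] L v by simp
  qed
  ultimately show ?thesis using LA L by (auto simp: psd_mat_def)
qed

lemma psd_mat_inv:
  assumes "psd_mat n A" and "det A \<noteq> 0"
  shows "psd_mat n (mat_inv A)"
proof -
  note A = psd_matD[OF assms(1)]
  note inv = mat_inv_det_nonzero[OF A(1) assms(2)]
  have sym: "transpose_mat (mat_inv A) = mat_inv A" by (rule mat_inv_sym[OF A(1) assms(2) A(2)])
  have "psd_mat n (transpose_mat (mat_inv A) * A * mat_inv A)"
    by (rule psd_mat_congruence[OF assms(1) inv(1)])
  then show ?thesis using sym inv by simp
qed

lemma if_zero_mult: "(if P then x else 0) * y = (if P then x * y else 0 :: real)" by simp
lemma mult_if_zero: "y * (if P then x else 0) = (if P then y * x else 0 :: real)" by simp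

text \<open>One step of a Cholesky decomposition; a zero pivot forces its whole row to vanish.\<close>

lemma psd_eliminate:
  fixes a :: "nat \<Rightarrow> nat \<Rightarrow> real"
  assumes sym: "\<And>p q. p < n \<Longrightarrow> q < n \<Longrightarrow> a p q = a q p"
    and psd: "\<And>v. 0 \<le> (\<Sum>p<n. \<Sum>q<n. v p * a p q * v q)"
    and k: "k < n"
  shows "\<exists>c. (\<forall>v. 0 \<le> (\<Sum>p<n. \<Sum>q<n. v p * (a p q - c p * c q) * v q)) \<and>
    (\<forall>q<n. a k q = c k * c q) \<and> (\<forall>p. a p k = 0 \<longrightarrow> c p = 0)"
proof -
  define Q where "Q v = (\<Sum>p<n. \<Sum>q<n. v p * a p q * v q)" for v
  define s where "s v = (\<Sum>p<n. v p * a p k)" for v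
  define e where "e p = (if p = k then 1 else 0 :: real)" for p
  have Q_shift: "Q (\<lambda>p. v p + t * e p) = Q v + 2 * t * s v + t\<^sup>2 * a k k" for v t
  proof -
    have "Q (\<lambda>p. v p + t * e p) = Q v + t * (\<Sum>p<n. \<Sum>q<n. v p * a p q * e q)
        + t * (\<Sum>p<n. \<Sum>q<n. e p * a p q * v q) + t\<^sup>2 * (\<Sum>p<n. \<Sum>q<n. e p * a p q * e q)"
      unfolding Q_def sum_distrib_left sum.distrib[symmetric]
      by (intro sum.cong refl) (simp add: algebra_simps power2_eq_square)
    moreover have "(\<Sum>p<n. \<Sum>q<n. v p * a p q * e q) = s v"
      unfolding s_def e_def using k by (simp add: if_zero_mult mult_if_zero)
    moreover have "(\<Sum>p<n. \<Sum>q<n. e p * a p q * v q) = s v"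
    proof -
      have "(\<Sum>p<n. \<Sum>q<n. e p * a p q * v q) = (\<Sum>p<n. e p * (\<Sum>q<n. a p q * v q))"
        by (simp add: sum_distrib_left mult.assoc)
      also have "\<dots> = (\<Sum>q<n. a k q * v q)"
        unfolding e_def using k by (simp add: if_zero_mult mult_if_zero)
      also have "\<dots> = s v" unfolding s_def using sym k by (intro sum.cong) (auto simp: mult.commute)
      finally show ?thesis .
    qed
    moreover have "(\<Sum>p<n. \<Sum>q<n. e p * a p q * e q) = a k k"
    proof -
      have "(\<Sum>p<n. \<Sum>q<n. e p * a p q * e q) = (\<Sum>p<n. e p * (\<Sum>q<n. a p q * e q))"
        by (simp add: sum_distrib_left mult.assoc)
      then show ?thesis unfolding e_def using k by (simp add: if_zero_mult mult_if_zero)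
    qed
    ultimately show ?thesis by simp
  qed
  have nonneg: "0 \<le> Q v + 2 * t * s v + t\<^sup>2 * a k k" for v t
    using psd[of "\<lambda>p. v p + t * e p"] Q_shift[of v t] by (simp add: Q_def)
  have akk: "0 \<le> a k k"
    using nonneg[of "\<lambda>_. 0" 1] by (simp add: Q_def s_def)
  show ?thesis
  proof (cases "a k k = 0")
    case True
    have "s v = 0" for v
    proof (rule ccontr)
      assume "s v \<noteq> 0"
      then have "Q v + 2 * (- (Q v + 1) / (2 * s v)) * s v = - 1" by (simp add: field_simps)
      then show False using nonneg[of v "- (Q v + 1) / (2 * s v)"] True by simp
    qed
    moreover have "s (\<lambda>q. if q = p then 1 else 0) = a p k" if "p < n" for p
      using that unfolding s_def by (simp add: if_zero_mult mult_if_zero)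
    ultimately have "a p k = 0" if "p < n" for p
      using that by metis
    then have "a k q = 0" if "q < n" for q using sym[OF k that] that by simp
    then show ?thesis using psd by (intro exI[of _ "\<lambda>_. 0"]) auto
  next
    case False
    then have pos: "0 < a k k" using akk by simp
    define c where "c p = a p k / sqrt (a k k)" for p
    have cc: "c p * c q = a p k * a q k / a k k" for p q
      unfolding c_def using pos by simp
    have "0 \<le> (\<Sum>p<n. \<Sum>q<n. v p * (a p q - c p * c q) * v q)" for v
    proof -
      have "(\<Sum>p<n. \<Sum>q<n. v p * (a p q - c p * c q) * v q) = Q v - (\<Sum>p<n. v p * c p) * (\<Sum>q<n. v q * c q)"
        unfolding Q_def sum_product sum_subtractf[symmetric]
        by (intro sum.cong refl) (simp add: algebra_simps)
      also have "(\<Sum>p<n. v p * c p) = s v / sqrt (a k k)"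
        unfolding c_def s_def by (simp add: sum_divide_distrib)
      also have "Q v - s v / sqrt (a k k) * (s v / sqrt (a k k))
          = Q v + 2 * (- s v / a k k) * s v + (- s v / a k k)\<^sup>2 * a k k"
        using pos by (simp add: power2_eq_square field_simps)
      finally show ?thesis using nonneg[of v "- s v / a k k"] by simp
    qed
    moreover have "a k q = c k * c q" if "q < n" for q
      using pos sym[OF k that] unfolding cc by simp
    moreover have "c p = 0" if "a p k = 0" for p using that by (simp add: c_def)
    ultimately show ?thesis by blast
  qed
qed

lemma psd_sum_squares:
  fixes a :: "nat \<Rightarrow> nat \<Rightarrow> real"
  assumes sym: "\<And>p q. p < n \<Longrightarrow> q < n \<Longrightarrow> a p q = a q p"
    and psd: "\<And>v. 0 \<le> (\<Sum>p<n. \<Sum>q<n. v p * a p q * v q)"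
  shows "\<exists>b. \<forall>p<n. \<forall>q<n. a p q = (\<Sum>j<n. b j p * b j q)"
proof -
  have "\<exists>b. (\<forall>v. 0 \<le> (\<Sum>p<n. \<Sum>q<n. v p * (a p q - (\<Sum>j<k. b j p * b j q)) * v q)) \<and>
      (\<forall>p<k. \<forall>q<n. a p q = (\<Sum>j<k. b j p * b j q))" if "k \<le> n" for k
    using that
  proof (induction k)
    case 0
    show ?case using psd by simp
  next
    case (Suc k)
    then obtain b where b: "\<And>v. 0 \<le> (\<Sum>p<n. \<Sum>q<n. v p * (a p q - (\<Sum>j<k. b j p * b j q)) * v q)"
      and bk: "\<And>p q. p < k \<Longrightarrow> q < n \<Longrightarrow> a p q = (\<Sum>j<k. b j p * b j q)" by (auto simp: Suc_le_eq)
    have k: "k < n" using Suc.prems by simp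
    define r where "r p q = a p q - (\<Sum>j<k. b j p * b j q)" for p q
    have r_sym: "r p q = r q p" if "p < n" "q < n" for p q
      unfolding r_def using sym[OF that] by (simp add: mult.commute)
    have r_psd: "0 \<le> (\<Sum>p<n. \<Sum>q<n. v p * r p q * v q)" for v
      unfolding r_def by (rule b)
    obtain c where c: "\<And>v. 0 \<le> (\<Sum>p<n. \<Sum>q<n. v p * (r p q - c p * c q) * v q)"
      and ck: "\<And>q. q < n \<Longrightarrow> r k q = c k * c q" and c0: "\<And>p. r p k = 0 \<Longrightarrow> c p = 0"
      using psd_eliminate[of n r k, OF r_sym r_psd k] by auto
    define b' where "b' = b(k := c)"
    have sum_b': "(\<Sum>j<Suc k. b' j p * b' j q) = (\<Sum>j<k. b j p * b j q) + c p * c q" for p q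
    proof -
      have "(\<Sum>j<k. b' j p * b' j q) = (\<Sum>j<k. b j p * b j q)"
        unfolding b'_def by (intro sum.cong) auto
      then show ?thesis by (simp add: b'_def)
    qed
    have "a p q = (\<Sum>j<Suc k. b' j p * b' j q)" if "p < Suc k" "q < n" for p q
    proof (cases "p = k")
      case True
      then show ?thesis using ck[OF that(2)] by (simp add: r_def sum_b' del: sum.lessThan_Suc)
    next
      case False
      then have "p < k" using that by simp
      then show ?thesis using bk[of p q] bk[of p k] c0[of p] that k
        by (simp add: r_def sum_b' del: sum.lessThan_Suc)
    qed
    moreover have "r p q - c p * c q = a p q - (\<Sum>j<Suc k. b' j p * b' j q)" for p q
      by (simp add: r_def sum_b' del: sum.lessThan_Suc)
    then have "0 \<le> (\<Sum>p<n. \<Sum>q<n. v p * (a p q - (\<Sum>j<Suc k. b' j p * b' j q)) * v q)" for v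
      using c[of v] by (simp del: sum.lessThan_Suc)
    ultimately show ?case by blast
  qed
  from this[of n] show ?thesis by auto
qed

lemma quadratic_form_sum:
  fixes A :: "real mat"
  assumes A: "A \<in> carrier_mat n n"
  shows "vec n v \<bullet> (A *\<^sub>v vec n v) = (\<Sum>p<n. \<Sum>q<n. v p * A $$ (p, q) * v q)"
  using A by (simp add: scalar_prod_def sum_distrib_left mult.assoc lessThan_atLeast0)

lemma psd_mat_rank_one_sum:
  assumes "psd_mat n A"
  obtains b where "\<And>p q. p < n \<Longrightarrow> q < n \<Longrightarrow> A $$ (p, q) = (\<Sum>j<n. b j p * b j q)"
proof -
  note A = psd_matD[OF assms]
  have "A $$ (p, q) = A $$ (q, p)" if "p < n" "q < n" for p q
    using A(1,2) that by (metis carrier_matD index_transpose_mat(1))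
  moreover have "0 \<le> (\<Sum>p<n. \<Sum>q<n. v p * A $$ (p, q) * v q)" for v
    using A(3)[of "vec n v"] quadratic_form_sum[OF A(1), of v] by simp
  ultimately show ?thesis
    using psd_sum_squares[of n "\<lambda>p q. A $$ (p, q)"] that by blast
qed

lemma psd_mat_factor:
  assumes "psd_mat n A"
  obtains B where "B \<in> carrier_mat n n" "A = B * transpose_mat B"
proof -
  obtain b where b: "\<And>p q. p < n \<Longrightarrow> q < n \<Longrightarrow> A $$ (p, q) = (\<Sum>j<n. b j p * b j q)"
    using psd_mat_rank_one_sum[OF assms] by blast
  define B where "B = mat n n (\<lambda>(p, j). b j p)"
  have "A = B * transpose_mat B"
    using psd_matD(1)[OF assms] b
    by (intro eq_matI) (auto simp: B_def scalar_prod_def lessThan_atLeast0)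
  then show ?thesis using that[of B] by (simp add: B_def)
qed

definition outer_mat :: "nat \<Rightarrow> (nat \<Rightarrow> real) \<Rightarrow> real mat" where
  "outer_mat n b = mat n n (\<lambda>(p, q). b p * b q)"

lemma outer_mat_carrier [simp]: "outer_mat n b \<in> carrier_mat n n"
  by (simp add: outer_mat_def)

lemma outer_mat_dim [simp]: "dim_row (outer_mat n b) = n" "dim_col (outer_mat n b) = n"
  by (simp_all add: outer_mat_def)

lemma psd_outer_mat: "psd_mat n (outer_mat n b)"
proof -
  have "0 \<le> v \<bullet> (outer_mat n b *\<^sub>v v)" if v: "v \<in> carrier_vec n" for v
  proof -
    have "v = vec n (($) v)" using v by (intro eq_vecI) auto
    then have "v \<bullet> (outer_mat n b *\<^sub>v v) = (\<Sum>p<n. \<Sum>q<n. v $ p * (b p * b q) * v $ q)"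
      using quadratic_form_sum[of "outer_mat n b" n "($) v"] by (simp add: outer_mat_def)
    also have "\<dots> = (\<Sum>p<n. v $ p * b p) * (\<Sum>p<n. v $ p * b p)"
      unfolding sum_product by (intro sum.cong refl) (simp add: algebra_simps)
    finally show ?thesis by simp
  qed
  then show ?thesis by (auto simp: psd_mat_def outer_mat_def intro!: eq_matI)
qed

lemma psd_mat_induct [consumes 1, case_names zero add]:
  assumes "psd_mat n A"
    and zero: "Q (0\<^sub>m n n)"
    and add: "\<And>A b. psd_mat n A \<Longrightarrow> Q A \<Longrightarrow> Q (A + outer_mat n b)"
  shows "Q A"
proof -
  obtain b where b: "\<And>p q. p < n \<Longrightarrow> q < n \<Longrightarrow> A $$ (p, q) = (\<Sum>j<n. b j p * b j q)"
    using psd_mat_rank_one_sum[OF assms(1)] by blast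
  define S where "S k = mat n n (\<lambda>(p, q). \<Sum>j<k. b j p * b j q)" for k :: nat
  have "psd_mat n (S k) \<and> Q (S k)" for k
  proof (induction k)
    case 0
    have "S 0 = 0\<^sub>m n n" by (auto simp: S_def)
    then show ?case using zero psd_mat_zero by simp
  next
    case (Suc k)
    have "S (Suc k) = S k + outer_mat n (b k)" by (auto simp: S_def outer_mat_def)
    then show ?case using Suc add psd_mat_add psd_outer_mat by simp
  qed
  moreover have "S n = A" using psd_matD(1)[OF assms(1)] b by (auto simp: S_def)
  ultimately show ?thesis by metis
qed

section \<open>Submodularity of the determinant\<close>

lemma psd_mat_one: "psd_mat n (1\<^sub>m n)"
  by (auto simp: psd_mat_def scalar_prod_def intro!: sum_nonneg)

lemma det_add_outer_mat:
  assumes X: "X \<in> carrier_mat m m" and p: "p \<in> carrier_vec m" and Xp: "X *\<^sub>v p = vec m c"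
  shows "det (X + outer_mat m c) = det X * (1 + vec m c \<bullet> p)"
proof -
  define U where "U = mat m 1 (\<lambda>(i, j). p $ i)"
  define V where "V = mat 1 m (\<lambda>(i, j). c j)"
  have U: "U \<in> carrier_mat m 1" and V: "V \<in> carrier_mat 1 m" by (auto simp: U_def V_def)
  have "(X * U) $$ (i, 0) = c i" if "i < m" for i
  proof -
    have "(X * U) $$ (i, 0) = (X *\<^sub>v p) $ i"
      using X p that by (auto simp: U_def scalar_prod_def)
    then show ?thesis using Xp that by simp
  qed
  then have "X * U * V = outer_mat m c"
    using X U V by (intro eq_matI) (auto simp: outer_mat_def V_def scalar_prod_def)
  then have "X + outer_mat m c = X * (1\<^sub>m m + U * V)"
    using X U V by (simp add: mult_add_distrib_mat[where n = m and nr = m and nc = m] assoc_mult_mat[where ?n\<^sub>1 = m])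
  moreover have "det (1\<^sub>m 1 + V * U) = 1 + (V * U) $$ (0, 0)"
    using U V by (subst det_single) auto
  moreover have "(V * U) $$ (0, 0) = vec m c \<bullet> p"
    using p by (auto simp: U_def V_def scalar_prod_def)
  ultimately show ?thesis
    using det_one_plus_mult_comm[OF U V] det_mult[of X m "1\<^sub>m m + U * V"] X U V by simp
qed

lemma det_one_plus_add_outer_mat:
  assumes A: "psd_mat m A" and "det (1\<^sub>m m + A) \<noteq> 0"
  obtains p where "p \<in> carrier_vec m" "(1\<^sub>m m + A) *\<^sub>v p = vec m c" "0 \<le> vec m c \<bullet> p"
    "det (1\<^sub>m m + A + outer_mat m c) = det (1\<^sub>m m + A) * (1 + vec m c \<bullet> p)"
proof -
  let ?X = "1\<^sub>m m + A"
  have psd: "psd_mat m ?X" by (rule psd_mat_add[OF psd_mat_one A])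
  note X = psd_matD[OF psd]
  note inv = mat_inv_det_nonzero[OF X(1) assms(2)]
  define p where "p = mat_inv ?X *\<^sub>v vec m c"
  have p: "p \<in> carrier_vec m" using inv(1) by (simp add: p_def)
  have Xp: "?X *\<^sub>v p = vec m c"
    using assoc_mult_mat_vec[OF X(1) inv(1), of "vec m c"] inv(2) by (simp add: p_def)
  have "0 \<le> vec m c \<bullet> p"
    using X(3)[OF p] comm_scalar_prod[of p m "vec m c"] p unfolding Xp by simp
  then show thesis using that[OF p Xp] det_add_outer_mat[OF X(1) p Xp] by simp
qed

lemma det_one_plus_psd_pos:
  assumes "psd_mat m A"
  shows "0 < det (1\<^sub>m m + A)"
  using assms
proof (induction rule: psd_mat_induct)
  case (add A c)
  obtain p where "0 \<le> vec m c \<bullet> p" 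
    "det (1\<^sub>m m + A + outer_mat m c) = det (1\<^sub>m m + A) * (1 + vec m c \<bullet> p)"
    using det_one_plus_add_outer_mat[OF add(1), of c] add(2) by (metis less_irrefl)
  moreover have "1\<^sub>m m + (A + outer_mat m c) = 1\<^sub>m m + A + outer_mat m c"
    using psd_matD(1)[OF add(1)] outer_mat_carrier[of m c] by (intro eq_matI) auto
  ultimately show ?case using add(2) by simp
qed simp

lemma det_one_plus_psd_mono:
  assumes A: "psd_mat m A" and "psd_mat m B"
  shows "det (1\<^sub>m m + A) \<le> det (1\<^sub>m m + (A + B))"
  using assms(2)
proof (induction rule: psd_mat_induct)
  case zero
  then show ?case using psd_matD(1)[OF A] by simp
next
  case (add B c)
  have AB: "psd_mat m (A + B)" by (rule psd_mat_add[OF A add(1)])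
  note pos = det_one_plus_psd_pos[OF AB]
  obtain p where p: "0 \<le> vec m c \<bullet> p" 
    "det (1\<^sub>m m + (A + B) + outer_mat m c) = det (1\<^sub>m m + (A + B)) * (1 + vec m c \<bullet> p)"
    using det_one_plus_add_outer_mat[OF AB, of c] pos by (metis less_irrefl)
  have "det (1\<^sub>m m + (A + B)) \<le> det (1\<^sub>m m + (A + B)) * (1 + vec m c \<bullet> p)"
    using p pos by (simp add: algebra_simps)
  moreover have "1\<^sub>m m + (A + (B + outer_mat m c)) = 1\<^sub>m m + (A + B) + outer_mat m c"
    using psd_matD(1)[OF A] psd_matD(1)[OF add(1)] outer_mat_carrier[of m c] by (intro eq_matI) auto
  ultimately show ?case using add(2) p by simp
qed

text \<open>Stated with solutions \<open>p = X\<^sup>-\<^sup>1 a\<close> and \<open>q = (X + B)\<^sup>-\<^sup>1 a\<close>, which avoids inverses. The proof expands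
  \<open>0 \<le> (p - q)\<^sup>T X (p - q)\<close>.\<close>

lemma inverse_form_antimono:
  assumes X: "psd_mat m X" and B: "psd_mat m B"
    and p: "p \<in> carrier_vec m" and q: "q \<in> carrier_vec m"
    and Xp: "X *\<^sub>v p = a" and Xq: "(X + B) *\<^sub>v q = a"
  shows "a \<bullet> q \<le> a \<bullet> p"
proof -
  note X' = psd_matD[OF X] and B' = psd_matD[OF B]
  have a: "a \<in> carrier_vec m" using Xp X'(1) p by auto
  have a_eq: "X *\<^sub>v q + B *\<^sub>v q = a"
    using Xq add_mult_distrib_mat_vec[OF X'(1) B'(1) q] by simp
  have pq: "p - q \<in> carrier_vec m" using p q by simp
  have "q \<bullet> (X *\<^sub>v q) + q \<bullet> (B *\<^sub>v q) = q \<bullet> a"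
    unfolding a_eq[symmetric]
    using X'(1) B'(1) q by (simp add: scalar_prod_add_distrib[where n = m])
  moreover have "0 \<le> q \<bullet> (B *\<^sub>v q)" by (rule B'(3)[OF q])
  moreover have "0 \<le> (p - q) \<bullet> (X *\<^sub>v (p - q))" by (rule X'(3)[OF pq])
  moreover have "(p - q) \<bullet> (X *\<^sub>v (p - q)) = p \<bullet> a - p \<bullet> (X *\<^sub>v q) - (q \<bullet> a - q \<bullet> (X *\<^sub>v q))"
    using X'(1) p q a Xp
    by (simp add: mult_minus_distrib_mat_vec[where nr = m and nc = m] minus_scalar_prod_distrib[where n = m]
        scalar_prod_minus_distrib[where n = m])
  moreover have "p \<bullet> (X *\<^sub>v q) = a \<bullet> q"
    using transpose_vec_mult_scalar[OF X'(1) q p] X'(2) Xp by simp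
  ultimately show ?thesis
    using comm_scalar_prod[OF a p] comm_scalar_prod[OF a q] by simp
qed

lemma det_one_plus_psd_submodular:
  assumes A: "psd_mat m A" and B: "psd_mat m B" and "psd_mat m C"
  shows "det (1\<^sub>m m + (A + B + C)) * det (1\<^sub>m m + A)
    \<le> det (1\<^sub>m m + (A + B)) * det (1\<^sub>m m + (A + C))"
  using assms(3)
proof (induction rule: psd_mat_induct)
  case zero
  then show ?case using psd_matD(1)[OF A] psd_matD(1)[OF B] by simp
next
  case (add C c)
  have AC: "psd_mat m (A + C)" by (rule psd_mat_add[OF A add(1)])
  have ABC: "psd_mat m (A + B + C)" by (intro psd_mat_add A B add(1))
  note carr = psd_matD(1)[OF A] psd_matD(1)[OF B] psd_matD(1)[OF add(1)]
  note pos = det_one_plus_psd_pos[OF A] det_one_plus_psd_pos[OF AC] det_one_plus_psd_pos[OF ABC]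
  obtain p where p: "p \<in> carrier_vec m" "(1\<^sub>m m + (A + C)) *\<^sub>v p = vec m c" "0 \<le> vec m c \<bullet> p"
    "det (1\<^sub>m m + (A + C) + outer_mat m c) = det (1\<^sub>m m + (A + C)) * (1 + vec m c \<bullet> p)"
    using det_one_plus_add_outer_mat[OF AC, of c] pos by (metis less_irrefl)
  obtain q where q: "q \<in> carrier_vec m" "(1\<^sub>m m + (A + B + C)) *\<^sub>v q = vec m c" "0 \<le> vec m c \<bullet> q"
    "det (1\<^sub>m m + (A + B + C) + outer_mat m c) = det (1\<^sub>m m + (A + B + C)) * (1 + vec m c \<bullet> q)"
    using det_one_plus_add_outer_mat[OF ABC, of c] pos by (metis less_irrefl)
  have "1\<^sub>m m + (A + B + C) = 1\<^sub>m m + (A + C) + B"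
    using carr by (intro eq_matI) auto
  then have qp: "vec m c \<bullet> q \<le> vec m c \<bullet> p"
    using inverse_form_antimono[OF psd_mat_add[OF psd_mat_one AC] B p(1) q(1) p(2)] q(2) by simp
  have "det (1\<^sub>m m + (A + B + C)) * (1 + vec m c \<bullet> q) * det (1\<^sub>m m + A)
      = det (1\<^sub>m m + (A + B + C)) * det (1\<^sub>m m + A) * (1 + vec m c \<bullet> q)" by simp
  also have "\<dots> \<le> det (1\<^sub>m m + (A + B)) * det (1\<^sub>m m + (A + C)) * (1 + vec m c \<bullet> p)"
    using qp q(3) pos det_one_plus_psd_pos[OF psd_mat_add[OF A B]]
    by (intro mult_mono[OF add(2)]) (auto intro!: mult_nonneg_nonneg)
  finally have "det (1\<^sub>m m + (A + B + C) + outer_mat m c) * det (1\<^sub>m m + A)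
      \<le> det (1\<^sub>m m + (A + B)) * det (1\<^sub>m m + (A + C) + outer_mat m c)"
    using p(4) q(4) by (simp add: mult.assoc)
  moreover have "1\<^sub>m m + (A + B + (C + outer_mat m c)) = 1\<^sub>m m + (A + B + C) + outer_mat m c"
    "1\<^sub>m m + (A + (C + outer_mat m c)) = 1\<^sub>m m + (A + C) + outer_mat m c"
    using carr outer_mat_carrier[of m c] by (auto intro!: eq_matI)
  ultimately show ?case by simp
qed

section \<open>The Kalman filter as a determinant\<close>

text \<open>The simplifier can discharge the dimension equations below, but not the premises
  \<^term>\<open>A \<in> carrier_mat n m\<close> of the library versions, whose dimensions do not occur in the conclusion.\<close>

lemma mult_assoc_dim:
  "dim_col A = dim_row B \<Longrightarrow> dim_col B = dim_row C \<Longrightarrow> A * B * C = A * (B * (C :: 'a :: semiring_0 mat))"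
  by (rule assoc_mult_mat) auto

lemma add_mult_distrib_dim:
  "dim_row A = dim_row B \<Longrightarrow> dim_col A = dim_col B \<Longrightarrow> dim_col B = dim_row C \<Longrightarrow>
    (A + B) * C = A * C + B * (C :: 'a :: semiring_0 mat)"
  by (rule add_mult_distrib_mat) auto

lemma mult_add_distrib_dim:
  "dim_col A = dim_row B \<Longrightarrow> dim_row B = dim_row C \<Longrightarrow> dim_col B = dim_col C \<Longrightarrow>
    A * (B + C) = A * B + A * (C :: 'a :: semiring_0 mat)"
  by (rule mult_add_distrib_mat) auto

lemma transpose_mult_dim:
  "dim_col A = dim_row B \<Longrightarrow> transpose_mat (A * B) = transpose_mat B * transpose_mat (A :: 'a :: comm_semiring_0 mat)"
  by (rule transpose_mult) auto

lemma transpose_add_dim: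
  "dim_row A = dim_row B \<Longrightarrow> dim_col A = dim_col B \<Longrightarrow>
    transpose_mat (A + B) = transpose_mat A + transpose_mat (B :: 'a :: semiring_0 mat)"
  by (rule transpose_add) auto

lemmas mat_expand = mult_assoc_dim add_mult_distrib_dim mult_add_distrib_dim transpose_mult_dim transpose_add_dim

lemma det_psd_nonneg:
  assumes "psd_mat n A"
  shows "0 \<le> det A"
proof -
  obtain B where "B \<in> carrier_mat n n" "A = B * transpose_mat B"
    using psd_mat_factor[OF assms] by blast
  then show ?thesis using det_mult[of B n "transpose_mat B"] det_transpose[of B n] by simp
qed

lemma information_update:
  assumes X: "X \<in> carrier_mat m m" and L: "L \<in> carrier_mat n m" and M: "M \<in> carrier_mat n n"
    and detX: "det X \<noteq> 0" and P: "P = L * mat_inv X * transpose_mat L" and detP: "det P \<noteq> 0"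
    and X': "X' = X + transpose_mat L * M * L" and detX': "det X' \<noteq> 0"
  shows "mat_inv (mat_inv P + M) = L * mat_inv X' * transpose_mat L"
    and "det X' = det X * det P * det (mat_inv P + M)"
    and "det (mat_inv P + M) * det (L * mat_inv X' * transpose_mat L) = 1"
proof -
  define Y Y' where "Y = mat_inv X" and "Y' = mat_inv X'"
  have Pc: "P \<in> carrier_mat n n" and X'c: "X' \<in> carrier_mat m m"
    using X L M mat_inv_det_nonzero(1)[OF X detX] by (auto simp: P X')
  note Y = mat_inv_det_nonzero[OF X detX, folded Y_def]
  note Y' = mat_inv_det_nonzero[OF X'c detX', folded Y'_def]
  define R where "R = mat_inv P"
  note R = mat_inv_det_nonzero[OF Pc detP, folded R_def]
  define Q where "Q = L * Y' * transpose_mat L"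
  have Q: "Q \<in> carrier_mat n n" using L Y'(1) by (simp add: Q_def)
  note dims = carrier_matD[OF X] carrier_matD[OF L] carrier_matD[OF M] carrier_matD[OF Pc]
    carrier_matD[OF Y(1)] carrier_matD[OF Y'(1)] carrier_matD[OF R(1)] carrier_matD[OF Q] carrier_matD[OF X'c]
  have "L * Y * X' = L + P * M * L"
    using Y(3) right_mult_one_mat[OF L] unfolding X' P Y_def[symmetric]
    by (simp add: mat_expand dims)
  then have "L * Y * X' * (Y' * transpose_mat L) = (L + P * M * L) * (Y' * transpose_mat L)" by simp
  moreover have "L * Y * X' * (Y' * transpose_mat L) = L * Y * (X' * Y') * transpose_mat L"
    by (simp add: mat_expand dims)
  ultimately have "P = (L + P * M * L) * (Y' * transpose_mat L)"
    using right_mult_one_mat[of "L * Y" n m] L Y(1) by (simp add: Y'(2) P Y_def)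
  also have "\<dots> = Q + P * (M * Q)"
    by (simp add: Q_def mat_expand dims)
  finally have "R * P = R * (Q + P * (M * Q))" by simp
  also have "\<dots> = R * Q + R * P * (M * Q)" by (simp add: mat_expand dims)
  also have "\<dots> = (R + M) * Q"
    using left_mult_one_mat[of "M * Q" n n] M Q by (simp add: R(3) mat_expand dims)
  finally have inv: "(R + M) * Q = 1\<^sub>m n" using R(3) by simp
  have RM: "R + M \<in> carrier_mat n n" using R(1) M by simp
  show "mat_inv (mat_inv P + M) = L * mat_inv X' * transpose_mat L"
    using mat_inv_unique[OF RM Q inv] by (simp add: R_def Q_def Y'_def)
  show "det (mat_inv P + M) * det (L * mat_inv X' * transpose_mat L) = 1"
    using det_mult[OF RM Q] inv by (simp add: R_def Q_def Y'_def)
  define U V where "U = Y * transpose_mat L" and "V = M * L"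
  have U: "U \<in> carrier_mat m n" and V: "V \<in> carrier_mat n m" using Y(1) L M by (auto simp: U_def V_def)
  have "X * (1\<^sub>m m + U * V) = X + X * Y * (transpose_mat L * (M * L))"
    using right_mult_one_mat[OF X] by (simp add: U_def V_def mat_expand dims)
  also have "\<dots> = X'"
    using left_mult_one_mat[of "transpose_mat L * (M * L)" m m] L M by (simp add: Y(2) X' mat_expand dims)
  finally have "det X' = det X * det (1\<^sub>m m + U * V)"
    using det_mult[OF X, of "1\<^sub>m m + U * V"] U V by simp
  also have "\<dots> = det X * det (1\<^sub>m n + V * U)"
    using det_one_plus_mult_comm[OF U V] by simp
  also have "V * U = M * P"
    unfolding U_def V_def P Y_def[symmetric] by (simp add: mat_expand dims)
  also have "1\<^sub>m n + M * P = (R + M) * P"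
    using R(3) by (simp add: mat_expand dims)
  also have "det \<dots> = det (R + M) * det P"
    by (rule det_mult[OF RM Pc])
  finally show "det X' = det X * det P * det (mat_inv P + M)" by (simp add: R_def)
qed

lemma factor_predict:
  assumes X: "X \<in> carrier_mat m m" and detX: "det X \<noteq> 0"
    and L: "L \<in> carrier_mat n m" and E: "E \<in> carrier_mat n m"
    and A: "A \<in> carrier_mat n n" and B: "B \<in> carrier_mat n n"
    and LE: "L * transpose_mat E = 0\<^sub>m n n" and EE: "E * transpose_mat E = 1\<^sub>m n"
    and XE: "X * transpose_mat E = transpose_mat E" and EX: "E * X = E"
  shows "(A * L + B * E) * mat_inv X * transpose_mat (A * L + B * E)
    = A * (L * mat_inv X * transpose_mat L) * transpose_mat A + B * transpose_mat B"
proof -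
  define Y where "Y = mat_inv X"
  note Y = mat_inv_det_nonzero[OF X detX, folded Y_def]
  note dims = carrier_matD[OF X] carrier_matD[OF L] carrier_matD[OF E] carrier_matD[OF A]
    carrier_matD[OF B] carrier_matD[OF Y(1)]
  have EL: "E * transpose_mat L = 0\<^sub>m n n"
    using arg_cong[OF LE, of transpose_mat] by (simp add: mat_expand dims)
  have "Y * transpose_mat E = Y * X * transpose_mat E" using XE by (simp add: mat_expand dims)
  then have YE: "Y * transpose_mat E = transpose_mat E"
    using left_mult_one_mat[of "transpose_mat E" m n] E by (simp add: Y(3))
  have "E * Y = E * X * Y" using EX by simp
  then have EY: "E * Y = E"
    using right_mult_one_mat[OF E] by (simp add: Y(2) mult_assoc_dim dims)
  have YEZ: "Y * (transpose_mat E * Z) = transpose_mat E * Z" if "dim_row Z = n" for Z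
    using that by (simp add: mult_assoc_dim[symmetric] dims YE)
  have EYZ: "E * (Y * Z) = E * Z" if "dim_row Z = m" for Z
    using that by (simp add: mult_assoc_dim[symmetric] dims EY)
  have LEZ: "L * (transpose_mat E * Z) = 0\<^sub>m n n" if "Z \<in> carrier_mat n n" for Z
    using that mult_assoc_dim[of L "transpose_mat E" Z] by (simp add: dims LE)
  have ELZ: "E * (transpose_mat L * Z) = 0\<^sub>m n n" if "Z \<in> carrier_mat n n" for Z
    using that mult_assoc_dim[of E "transpose_mat L" Z] by (simp add: dims EL)
  have EEZ: "E * (transpose_mat E * Z) = Z" if "Z \<in> carrier_mat n n" for Z
    using that mult_assoc_dim[of E "transpose_mat E" Z] by (simp add: dims EE)
  have [simp]: "A * 0\<^sub>m n n = 0\<^sub>m n n" "B * 0\<^sub>m n n = 0\<^sub>m n n" using A B by auto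
  have tA: "transpose_mat A \<in> carrier_mat n n" and tB: "transpose_mat B \<in> carrier_mat n n"
    using A B by auto
  have c: "A * (L * (Y * (transpose_mat L * transpose_mat A))) \<in> carrier_mat n n"
     "B * transpose_mat B \<in> carrier_mat n n"
    using A B L Y(1) by auto
  show ?thesis unfolding Y_def[symmetric]
    using c by (simp add: mat_expand dims YEZ EYZ LEZ[OF tB] ELZ[OF tA] EEZ[OF tB])
qed

text \<open>Picks the \<open>t\<close>-th of the \<open>N + 1\<close> blocks of length \<open>n\<close> of the noise vector \<open>\<xi>\<close>: block \<open>0\<close> drives the
  prior, block \<open>t + 1\<close> the process noise \<open>w\<^sub>t\<close>.\<close>

definition block_select :: "nat \<Rightarrow> nat \<Rightarrow> nat \<Rightarrow> real mat" where
  "block_select n N t = mat n (n * Suc N) (\<lambda>(i, j). if j = n * t + i then 1 else 0)"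

lemma block_select_carrier: "block_select n N t \<in> carrier_mat n (n * Suc N)"
  by (simp add: block_select_def)

lemma block_select_mult_transpose:
  assumes "s \<le> N" "t \<le> N"
  shows "block_select n N s * transpose_mat (block_select n N t) = (if s = t then 1\<^sub>m n else 0\<^sub>m n n)"
proof (rule eq_matI)
  fix i k assume "i < dim_row (if s = t then 1\<^sub>m n else 0\<^sub>m n n :: real mat)"
    "k < dim_col (if s = t then 1\<^sub>m n else 0\<^sub>m n n :: real mat)"
  then have ik: "i < n" "k < n" by (auto split: if_splits)
  have "n * s + i < n * s + n" using ik by simp
  also have "\<dots> \<le> n * Suc N" using assms(1) by (metis add.commute mult_Suc_right mult_le_mono2 Suc_le_mono)
  finally have less: "n * s + i < n * Suc N" .
  have "n * s + i = n * t + k \<longleftrightarrow> s = t \<and> i = k"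
  proof
    assume eq: "n * s + i = n * t + k"
    have "(n * s + i) div n = s" "(n * t + k) div n = t" using ik by auto
    then show "s = t \<and> i = k" using eq by auto
  qed simp
  moreover have "(block_select n N s * transpose_mat (block_select n N t)) $$ (i, k)
      = (\<Sum>j<n * Suc N. (if j = n * s + i then 1 else 0) * (if j = n * t + k then 1 else 0))"
    unfolding lessThan_atLeast0 using ik block_select_carrier[of n N]
    by (subst index_mult_mat) (auto simp: scalar_prod_def block_select_def simp del: mult_Suc_right intro!: sum.cong)
  ultimately show "(block_select n N s * transpose_mat (block_select n N t)) $$ (i, k)
      = (if s = t then 1\<^sub>m n else 0\<^sub>m n n) $$ (i, k)"
    using less ik by (simp add: if_zero_mult del: mult_Suc_right)
qed (auto simp: block_select_def)

primrec trajectory_factor :: "(nat \<Rightarrow> real mat) \<Rightarrow> (nat \<Rightarrow> real mat) \<Rightarrow> nat \<Rightarrow> nat \<Rightarrow> nat \<Rightarrow> real mat" where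
  "trajectory_factor A B n N 0 = B 0 * block_select n N 0"
| "trajectory_factor A B n N (Suc t) =
     A t * trajectory_factor A B n N t + B (Suc t) * block_select n N (Suc t)"

lemma trajectory_factor_carrier:
  assumes "\<And>t. A t \<in> carrier_mat n n" "\<And>t. B t \<in> carrier_mat n n"
  shows "trajectory_factor A B n N t \<in> carrier_mat n (n * Suc N)"
  using assms block_select_carrier[of n N]
  by (induction t) (auto simp del: mult_Suc_right intro!: mult_carrier_mat add_carrier_mat)

lemma trajectory_factor_select:
  assumes A: "\<And>t. A t \<in> carrier_mat n n" and B: "\<And>t. B t \<in> carrier_mat n n"
    and "s < t" "t \<le> N"
  shows "trajectory_factor A B n N s * transpose_mat (block_select n N t) = 0\<^sub>m n n"
  using assms(3)
proof (induction s)
  case 0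
  then show ?case using B[of 0] block_select_carrier[of n N] block_select_mult_transpose[of 0 N t n] assms(4)
    by (simp add: mult_assoc_dim carrier_matD[OF B] carrier_matD[OF block_select_carrier] del: mult_Suc_right)
next
  case (Suc s)
  then show ?case using B[of "Suc s"] A[of s] block_select_mult_transpose[of "Suc s" N t n] assms(4)
    by (simp add: mat_expand carrier_matD[OF A] carrier_matD[OF B] carrier_matD[OF block_select_carrier]
        carrier_matD[OF trajectory_factor_carrier[OF A B]] del: mult_Suc_right)
qed

lemma mat_sum_carrier [simp]: "mat_sum nr nc F I \<in> carrier_mat nr nc"
  by (simp add: mat_sum_def)

lemma mat_sum_empty [simp]: "mat_sum nr nc F {} = 0\<^sub>m nr nc"
  by (auto simp: mat_sum_def)

lemma mat_sum_union:
  assumes "finite I" "finite J" "I \<inter> J = {}"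
  shows "mat_sum nr nc F (I \<union> J) = mat_sum nr nc F I + mat_sum nr nc F J"
  using assms by (auto simp: mat_sum_def sum.union_disjoint intro!: eq_matI)

lemma mat_sum_insert:
  assumes "finite I" "i \<notin> I" "F i \<in> carrier_mat nr nc"
  shows "mat_sum nr nc F (insert i I) = mat_sum nr nc F I + F i"
  using assms by (auto simp: mat_sum_def intro!: eq_matI)

lemma mat_sum_psd:
  assumes "\<And>i. i \<in> I \<Longrightarrow> psd_mat n (F i)"
  shows "psd_mat n (mat_sum n n F I)"
proof (cases "finite I")
  case True
  then show ?thesis using assms
  proof (induction I)
    case (insert i I)
    then show ?case using psd_matD(1)[OF insert(4)[of i]] by (simp add: mat_sum_insert psd_mat_add)
  qed (simp add: psd_mat_zero)
next
  case False
  then have "mat_sum n n F I = 0\<^sub>m n n" by (auto simp: mat_sum_def)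
  then show ?thesis by (simp add: psd_mat_zero)
qed

lemma mat_sum_add:
  assumes "\<And>i. i \<in> I \<Longrightarrow> F i \<in> carrier_mat nr nc" "\<And>i. i \<in> I \<Longrightarrow> G i \<in> carrier_mat nr nc"
  shows "mat_sum nr nc (\<lambda>i. F i + G i) I = mat_sum nr nc F I + mat_sum nr nc G I"
proof -
  have "(F i + G i) $$ (p, q) = F i $$ (p, q) + G i $$ (p, q)" if "i \<in> I" "p < nr" "q < nc" for i p q
    using assms[OF that(1)] that by auto
  then show ?thesis by (auto simp: mat_sum_def sum.distrib[symmetric] intro!: eq_matI sum.cong)
qed

definition info_gram :: "nat \<Rightarrow> (nat \<Rightarrow> real mat) \<Rightarrow> (nat \<Rightarrow> real mat) \<Rightarrow> nat \<Rightarrow> real mat" where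
  "info_gram m L M t = mat_sum m m (\<lambda>\<tau>. transpose_mat (L \<tau>) * M \<tau> * L \<tau>) {1..t}"

lemma info_gram_0 [simp]: "info_gram m L M 0 = 0\<^sub>m m m"
  by (simp add: info_gram_def)

lemma info_gram_Suc:
  assumes "L (Suc t) \<in> carrier_mat n m"
  shows "info_gram m L M (Suc t) = info_gram m L M t + transpose_mat (L (Suc t)) * M (Suc t) * L (Suc t)"
proof -
  have "{1..Suc t} = insert (Suc t) {1..t}" by auto
  then show ?thesis
    unfolding info_gram_def using assms by (subst \<open>{1..Suc t} = _\<close>, subst mat_sum_insert) auto
qed

lemma info_gram_psd:
  assumes "\<And>\<tau>. \<tau> \<in> {1..t} \<Longrightarrow> L \<tau> \<in> carrier_mat n m" "\<And>\<tau>. \<tau> \<in> {1..t} \<Longrightarrow> psd_mat n (M \<tau>)"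
  shows "psd_mat m (info_gram m L M t)"
  unfolding info_gram_def using assms by (intro mat_sum_psd psd_mat_congruence)

lemma info_gram_add:
  assumes "\<And>\<tau>. \<tau> \<in> {1..t} \<Longrightarrow> L \<tau> \<in> carrier_mat n m"
    "\<And>\<tau>. \<tau> \<in> {1..t} \<Longrightarrow> M \<tau> \<in> carrier_mat n n" "\<And>\<tau>. \<tau> \<in> {1..t} \<Longrightarrow> M' \<tau> \<in> carrier_mat n n"
  shows "info_gram m L (\<lambda>\<tau>. M \<tau> + M' \<tau>) t = info_gram m L M t + info_gram m L M' t"
proof -
  have "transpose_mat (L \<tau>) * (M \<tau> + M' \<tau>) * L \<tau>
      = transpose_mat (L \<tau>) * M \<tau> * L \<tau> + transpose_mat (L \<tau>) * M' \<tau> * L \<tau>" if "\<tau> \<in> {1..t}" for \<tau>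
    using assms[OF that] by (simp add: mat_expand)
  then have "info_gram m L (\<lambda>\<tau>. M \<tau> + M' \<tau>) t = mat_sum m m (\<lambda>\<tau>.
      transpose_mat (L \<tau>) * M \<tau> * L \<tau> + transpose_mat (L \<tau>) * M' \<tau> * L \<tau>) {1..t}"
    by (auto simp: info_gram_def mat_sum_def intro!: eq_matI sum.cong)
  moreover have "transpose_mat (L \<tau>) * M \<tau> * L \<tau> \<in> carrier_mat m m"
    "transpose_mat (L \<tau>) * M' \<tau> * L \<tau> \<in> carrier_mat m m" if "\<tau> \<in> {1..t}" for \<tau>
    using assms(1)[OF that] by auto
  ultimately show ?thesis
    unfolding info_gram_def using mat_sum_add[of "{1..t}"] by simp
qed

lemma kalman_filter_log_det:
  fixes A B M C Q :: "nat \<Rightarrow> real mat" and n N :: nat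
  defines "m \<equiv> n * Suc N" and "L \<equiv> trajectory_factor A B n N"
  assumes A: "\<And>t. A t \<in> carrier_mat n n" and B: "\<And>t. B t \<in> carrier_mat n n"
    and M: "\<And>t. t \<in> {1..N} \<Longrightarrow> psd_mat n (M t)"
    and C0: "C 0 = B 0 * transpose_mat (B 0)"
    and Q: "\<And>t. t < N \<Longrightarrow> Q t = A t * C t * transpose_mat (A t) + B (Suc t) * transpose_mat (B (Suc t))"
    and C: "\<And>t. t < N \<Longrightarrow> C (Suc t) = mat_inv (mat_inv (Q t) + M (Suc t))"
    and det_Q: "\<And>t. t < N \<Longrightarrow> det (Q t) \<noteq> 0"
    and "t \<le> N"
  shows "C t = L t * mat_inv (1\<^sub>m m + info_gram m L M t) * transpose_mat (L t) \<and>
    (\<Sum>s<t. ln (det (Q s)) - ln (det (C (Suc s)))) = ln (det (1\<^sub>m m + info_gram m L M t))"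
  using assms(10)
proof (induction t)
  define E where "E t = block_select n N t" for t
  have Lc: "L t \<in> carrier_mat n m" for t
    unfolding L_def m_def by (rule trajectory_factor_carrier[OF A B])
  have Ec: "E t \<in> carrier_mat n m" for t unfolding E_def m_def by (rule block_select_carrier)
  {
    case 0
    have "mat_inv (1\<^sub>m m) = 1\<^sub>m m" by (rule mat_inv_unique) auto
    moreover have "L 0 = B 0 * E 0" by (simp add: L_def E_def)
    moreover have "E 0 * transpose_mat (E 0) = 1\<^sub>m n"
      unfolding E_def by (simp add: block_select_mult_transpose)
    then have "E 0 * (transpose_mat (E 0) * transpose_mat (B 0)) = transpose_mat (B 0)"
      using mult_assoc_dim[of "E 0" "transpose_mat (E 0)" "transpose_mat (B 0)"]
        carrier_matD[OF B[of 0]] carrier_matD[OF Ec[of 0]] by simp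
    ultimately show ?case
      using carrier_matD[OF B[of 0]] carrier_matD[OF Ec[of 0]]
      by (simp add: C0 mat_expand)
  next
    case (Suc t)
    then have t: "t < N" "Suc t \<le> N" by auto
    define X X' where "X = 1\<^sub>m m + info_gram m L M t" and "X' = 1\<^sub>m m + info_gram m L M (Suc t)"
    have gram: "psd_mat m (info_gram m L M s)" if "s \<le> N" for s
      using that by (intro info_gram_psd[where n = n] Lc M) auto
    have X: "psd_mat m X" unfolding X_def using t by (intro psd_mat_add psd_mat_one gram) auto
    have X': "psd_mat m X'" unfolding X'_def using t by (intro psd_mat_add psd_mat_one gram) auto
    have det: "0 < det X" "0 < det X'"
      unfolding X_def X'_def using t by (auto intro!: det_one_plus_psd_pos gram)
    have X'_X: "X' = X + transpose_mat (L (Suc t)) * M (Suc t) * L (Suc t)"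
      unfolding X'_def X_def info_gram_Suc[where L = L and t = t, OF Lc]
      using psd_matD(1)[OF gram[of t]] Lc[of "Suc t"] t by (intro eq_matI) auto
    have XE: "(1\<^sub>m m + info_gram m L M s) * transpose_mat (E (Suc t)) = transpose_mat (E (Suc t))"
      if "s \<le> t" for s
      using that
    proof (induction s)
      case 0
      show ?case using left_mult_one_mat[of "transpose_mat (E (Suc t))" m n] Ec[of "Suc t"] by simp
    next
      case (Suc s)
      have LE: "L (Suc s) * transpose_mat (E (Suc t)) = 0\<^sub>m n n"
        unfolding L_def E_def using Suc.prems t by (intro trajectory_factor_select A B) auto
      have carr: "info_gram m L M s \<in> carrier_mat m m" "M (Suc s) \<in> carrier_mat n n"
        using psd_matD(1)[OF gram[of s]] psd_matD(1)[OF M[of "Suc s"]] Suc.prems t by auto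
      have "1\<^sub>m m + info_gram m L M (Suc s)
          = 1\<^sub>m m + info_gram m L M s + transpose_mat (L (Suc s)) * M (Suc s) * L (Suc s)"
        unfolding info_gram_Suc[where L = L and t = s, OF Lc]
        using carr Lc[of "Suc s"] by (intro eq_matI) auto
      also have "\<dots> * transpose_mat (E (Suc t)) = (1\<^sub>m m + info_gram m L M s) * transpose_mat (E (Suc t))
          + transpose_mat (L (Suc s)) * M (Suc s) * (L (Suc s) * transpose_mat (E (Suc t)))"
        using carrier_matD[OF carr(1)] carrier_matD[OF carr(2)] carrier_matD[OF Lc[of "Suc s"]]
          carrier_matD[OF Ec[of "Suc t"]]
        by (simp add: mult_assoc_dim add_mult_distrib_dim[of "_ + _"])
      also have "\<dots> = transpose_mat (E (Suc t))"
        unfolding LE using Suc carr Lc[of "Suc s"] Ec[of "Suc t"] by simp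
      finally show ?case .
    qed
    have XE: "X * transpose_mat (E (Suc t)) = transpose_mat (E (Suc t))"
      using XE[of t] by (simp add: X_def)
    then have "transpose_mat (X * transpose_mat (E (Suc t))) = E (Suc t)" by simp
    then have EX: "E (Suc t) * X = E (Suc t)"
      using psd_matD(1,2)[OF X] Ec[of "Suc t"] by (simp add: transpose_mult_dim)
    have LE: "L t * transpose_mat (E (Suc t)) = 0\<^sub>m n n"
      unfolding L_def E_def using t by (intro trajectory_factor_select A B) auto
    have EE: "E (Suc t) * transpose_mat (E (Suc t)) = 1\<^sub>m n"
      unfolding E_def using t by (simp add: block_select_mult_transpose)
    have IH: "C t = L t * mat_inv X * transpose_mat (L t)"
      "(\<Sum>s<t. ln (det (Q s)) - ln (det (C (Suc s)))) = ln (det X)"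
      using Suc by (auto simp: X_def)
    have "L (Suc t) = A t * L t + B (Suc t) * E (Suc t)" by (simp add: L_def E_def)
    then have Q_eq: "Q t = L (Suc t) * mat_inv X * transpose_mat (L (Suc t))"
      using factor_predict[OF psd_matD(1)[OF X] _ Lc Ec A B LE EE XE EX, of t "Suc t"] det Q[OF t(1)] IH(1) by simp
    have "psd_mat m (mat_inv X)" using psd_mat_inv[OF X] det by simp
    then have "psd_mat n (Q t)"
      using psd_mat_congruence[of m "mat_inv X" "transpose_mat (L (Suc t))" n] Lc[of "Suc t"] Q_eq by simp
    then have det_pos: "0 < det (Q t)"
      using det_psd_nonneg det_Q[OF t(1)] by (simp add: order_less_le)
    define R where "R = mat_inv (Q t) + M (Suc t)"
    note upd = information_update[OF psd_matD(1)[OF X] Lc[of "Suc t"] psd_matD(1)[OF M[of "Suc t"]] _ Q_eq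
        det_Q[OF t(1)] X'_X, folded R_def]
    have CS: "C (Suc t) = L (Suc t) * mat_inv X' * transpose_mat (L (Suc t))"
      unfolding C[OF t(1)] R_def[symmetric] using upd(1) det t by simp
    have detX': "det X' = det X * det (Q t) * det R" using upd(2) det t by simp
    then have R_pos: "0 < det R" using det det_pos by (metis mult_pos_pos zero_less_mult_pos)
    have "det R * det (C (Suc t)) = 1" using upd(3) det t CS by simp
    then have "det (C (Suc t)) = inverse (det R)" using inverse_unique by metis
    then have "ln (det X') = ln (det X) + (ln (det (Q t)) - ln (det (C (Suc t))))"
      unfolding detX' using det det_pos R_pos by (simp add: ln_mult_pos ln_inverse)
    then show ?case using CS IH(2) by (simp add: X'_def)
  }
qed

section \<open>Mutual information of a set of trajectories\<close>

definition joint_info :: "('x, 'u) aia \<Rightarrow> (nat \<times> 'u list) set \<Rightarrow> nat \<Rightarrow> real mat" where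
  "joint_info P S t = mat_sum (target_dim P) (target_dim P)
     (\<lambda>(i, \<sigma>). sensor_info P i t (state_along P i \<sigma> t)) S"

lemma finite_ground: "valid_robots P \<Longrightarrow> finite (ground P)"
  unfolding ground_def robots_def robot_trajs_def valid_robots_def by auto

lemma state_along_in_state_space:
  assumes "valid_robots P" "i \<in> robots P" "\<sigma> \<in> trajs P i" "t \<le> horizon P"
  shows "state_along P i \<sigma> t \<in> state_space P i"
  using assms(4)
proof (induction t)
  case 0
  then show ?case using assms by (auto simp: valid_robots_def)
next
  case (Suc t)
  then have "\<sigma> ! t \<in> control_set P i"
    using assms(1-3) nth_mem[of t \<sigma>] by (fastforce simp: valid_robots_def)
  then show ?case using Suc assms(1,2) by (auto simp: valid_robots_def)
qed

lemma sensor_info_psd: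
  assumes "valid_robots P" "valid_sensors P" "(i, \<sigma>) \<in> ground P" "t \<in> {1..horizon P}"
  shows "psd_mat (target_dim P) (sensor_info P i t (state_along P i \<sigma> t))"
proof -
  let ?x = "state_along P i \<sigma> t"
  have i: "i \<in> robots P" and \<sigma>: "\<sigma> \<in> trajs P i"
    using assms(3) by (auto simp: ground_def robot_trajs_def)
  have "?x \<in> state_space P i" using state_along_in_state_space[OF assms(1) i \<sigma>] assms(4) by simp
  then have H: "sensor_map P i t ?x \<in> carrier_mat (sensor_dim P i) (target_dim P)"
    and V: "psd_mat (sensor_dim P i) (sensor_cov P i t ?x)" and "invertible_mat (sensor_cov P i t ?x)"
    using assms(2,4) i \<sigma> unfolding valid_sensors_def by blast+
  then have "det (sensor_cov P i t ?x) \<noteq> 0"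
    using invertible_det_nonzero psd_matD(1) by blast
  then show ?thesis
    unfolding sensor_info_def by (rule psd_mat_congruence[OF psd_mat_inv[OF V] H])
qed

lemma joint_info_psd:
  assumes "valid_robots P" "valid_sensors P" "S \<subseteq> ground P" "t \<in> {1..horizon P}"
  shows "psd_mat (target_dim P) (joint_info P S t)"
  unfolding joint_info_def using assms by (intro mat_sum_psd) (auto intro!: sensor_info_psd)

lemma indep_iff_inj_on_fst:
  assumes "valid_robots P"
  shows "S \<in> indep P \<longleftrightarrow> S \<subseteq> ground P \<and> inj_on fst S"
proof -
  have "(\<forall>i\<in>robots P. card (S \<inter> robot_trajs P i) \<le> 1) \<longleftrightarrow> inj_on fst S" if S: "S \<subseteq> ground P"
  proof -
    have fin: "finite (S \<inter> robot_trajs P i)" for i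
      using finite_subset[OF S finite_ground[OF assms]] by blast
    have in_robot: "e \<in> robot_trajs P i \<longleftrightarrow> fst e = i" if "e \<in> S" for e i
      using that S by (force simp: ground_def robot_trajs_def)
    have robot: "fst e \<in> robots P" if "e \<in> S" for e
      using that S by (auto simp: ground_def robot_trajs_def)
    have "card (S \<inter> robot_trajs P i) \<le> 1 \<longleftrightarrow> (\<forall>x\<in>S. \<forall>y\<in>S. fst x = i \<longrightarrow> fst y = i \<longrightarrow> x = y)" for i
      unfolding One_nat_def card_le_Suc0_iff_eq[OF fin] using in_robot by blast
    then show ?thesis unfolding inj_on_def using robot by (metis (no_types, lifting))
  qed
  then show ?thesis unfolding indep_def by auto
qed

lemma robot_trajs_Int_indep:
  assumes "valid_robots P" "S \<in> indep P" "(i, \<sigma>) \<in> S"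
  shows "robot_trajs P i \<inter> S = {(i, \<sigma>)}"
proof -
  have S: "S \<subseteq> ground P" "inj_on fst S" using assms indep_iff_inj_on_fst by auto
  have "e = (i, \<sigma>)" if "e \<in> robot_trajs P i \<inter> S" for e
    using inj_onD[OF S(2), of e "(i, \<sigma>)"] that assms(3) by (auto simp: robot_trajs_def)
  moreover have "(i, \<sigma>) \<in> robot_trajs P i"
    using S(1) assms(3) by (auto simp: ground_def robot_trajs_def)
  ultimately show ?thesis using assms(3) by blast
qed

lemma assigned_indep:
  assumes "valid_robots P" "S \<in> indep P"
  shows "assigned P S = fst ` S"
proof
  show "assigned P S \<subseteq> fst ` S"
  proof
    fix i assume "i \<in> assigned P S"
    then obtain e where "robot_trajs P i \<inter> S = {e}"
      by (auto simp: assigned_def card_1_singleton_iff)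
    then have "e \<in> S" "e \<in> robot_trajs P i" by auto
    then show "i \<in> fst ` S" by (force simp: robot_trajs_def)
  qed
  show "fst ` S \<subseteq> assigned P S"
  proof
    fix i assume "i \<in> fst ` S"
    then obtain \<sigma> where "(i, \<sigma>) \<in> S" by auto
    moreover have "i \<in> robots P" using calculation assms(2) by (auto simp: indep_def ground_def robot_trajs_def)
    ultimately show "i \<in> assigned P S"
      using robot_trajs_Int_indep[OF assms] by (simp add: assigned_def)
  qed
qed

lemma posterior_info_indep:
  assumes "valid_robots P" "S \<in> indep P"
  shows "posterior_info P S t \<Sigma> = mat_inv \<Sigma> + joint_info P S t"
proof -
  have inj: "inj_on fst S" using assms indep_iff_inj_on_fst by auto
  have state: "robot_state P S (fst e) t = state_along P (fst e) (snd e) t" if "e \<in> S" for e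
    using robot_trajs_Int_indep[OF assms, of "fst e" "snd e"] that by (cases e) (simp add: robot_state_def)
  have "mat_sum (target_dim P) (target_dim P) (\<lambda>i. sensor_info P i t (robot_state P S i t)) (fst ` S)
      = joint_info P S t"
    unfolding joint_info_def mat_sum_def
    by (intro cong_mat refl) (simp add: sum.reindex[OF inj] case_prod_beta state)
  then show ?thesis by (simp add: posterior_info_def assigned_indep[OF assms])
qed

lemma mutual_info_log_det:
  fixes P :: "('x, 'u) aia"
  assumes "aia_problem P"
  obtains m L where "\<And>t. L t \<in> carrier_mat (target_dim P) m"
    and "\<And>S. S \<in> indep P \<Longrightarrow>
      mutual_info P S = 1/2 * ln (det (1\<^sub>m m + info_gram m L (joint_info P S) (horizon P)))"
proof -
  let ?n = "target_dim P" and ?N = "horizon P"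
  have vr: "valid_robots P" and vt: "valid_target P" and vs: "valid_sensors P" and inv: "kf_inverses_exist P"
    using assms by (auto simp: aia_problem_def)
  have "\<exists>A. A \<in> carrier_mat ?n ?n \<and> (t < ?N \<longrightarrow> A = target_map P t)" for t
    using vt by (cases "t < ?N") (auto simp: valid_target_def intro: zero_carrier_mat)
  then obtain A where A: "\<And>t. A t \<in> carrier_mat ?n ?n" and A_eq: "\<And>t. t < ?N \<Longrightarrow> A t = target_map P t"
    by metis
  have "\<exists>W. W \<in> carrier_mat ?n ?n \<and> (t < ?N \<longrightarrow> process_cov P t = W * transpose_mat W)" for t
    using vt psd_mat_factor[of ?n "process_cov P t"]
    by (cases "t < ?N") (auto simp: valid_target_def intro: zero_carrier_mat)
  then obtain W where W: "\<And>t. W t \<in> carrier_mat ?n ?n"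
    and W_eq: "\<And>t. t < ?N \<Longrightarrow> process_cov P t = W t * transpose_mat (W t)" by metis
  obtain B0 where B0: "B0 \<in> carrier_mat ?n ?n" "prior_cov P = B0 * transpose_mat B0"
    using vt psd_mat_factor[of ?n "prior_cov P"] by (auto simp: valid_target_def)
  define B where "B t = (case t of 0 \<Rightarrow> B0 | Suc t \<Rightarrow> W t)" for t
  have B: "B t \<in> carrier_mat ?n ?n" for t using B0 W by (cases t) (auto simp: B_def)
  define L where "L = trajectory_factor A B ?n ?N"
  define m where "m = ?n * Suc ?N"
  have Lc: "L t \<in> carrier_mat ?n m" for t
    unfolding L_def m_def by (rule trajectory_factor_carrier[OF A B])
  moreover have "mutual_info P S = 1/2 * ln (det (1\<^sub>m m + info_gram m L (joint_info P S) ?N))"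
    if S: "S \<in> indep P" for S
  proof -
    have Sg: "S \<subseteq> ground P" using S by (simp add: indep_def)
    define C where "C = est_cov P S"
    define Q where "Q t = kf_predict P t (C t)" for t
    note info = joint_info_psd[OF vr vs Sg]
    have C_Suc: "C (Suc t) = mat_inv (mat_inv (Q t) + joint_info P S (Suc t))" for t
      unfolding C_def Q_def est_cov.simps kf_update_def posterior_info_indep[OF vr S] by simp
    have Q_eq: "Q t = A t * C t * transpose_mat (A t) + B (Suc t) * transpose_mat (B (Suc t))" if "t < ?N" for t
      using that by (simp add: Q_def kf_predict_def A_eq W_eq B_def)
    have "det (Q t) \<noteq> 0" if "t < ?N" for t
    proof -
      have "Q t \<in> carrier_mat ?n ?n"
        unfolding Q_eq[OF that] using A[of t] B[of "Suc t"] by auto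
      moreover have "invertible_mat (Q t)"
        using inv S that by (auto simp: kf_inverses_exist_def Q_def C_def)
      ultimately show ?thesis by (rule invertible_det_nonzero)
    qed
    moreover have "C 0 = B 0 * transpose_mat (B 0)" using B0 by (simp add: C_def B_def)
    ultimately have "(\<Sum>s<?N. ln (det (Q s)) - ln (det (C (Suc s))))
        = ln (det (1\<^sub>m m + info_gram m L (joint_info P S) ?N))"
      using kalman_filter_log_det[where A = A and B = B and n = ?n and N = ?N and C = C and Q = Q
          and M = "joint_info P S" and t = ?N, OF A B info _ Q_eq C_Suc] unfolding L_def m_def by simp
    moreover have "(\<Sum>t = 1..?N. ln (det (kf_predict P (t - 1) (est_cov P S (t - 1)))) - ln (det (est_cov P S t)))
        = (\<Sum>s<?N. ln (det (Q s)) - ln (det (C (Suc s))))"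
      by (simp add: sum.atLeast1_atMost_eq Q_def C_def lessThan_atLeast0 del: est_cov.simps)
    ultimately show ?thesis by (simp add: mutual_info_def)
  qed
  ultimately show thesis by (rule that)
qed

definition submodular_on :: "'a set \<Rightarrow> ('a set \<Rightarrow> real) \<Rightarrow> bool" where
  "submodular_on M F \<longleftrightarrow> (\<forall>S T. S \<subseteq> M \<longrightarrow> T \<subseteq> M \<longrightarrow> F (S \<union> T) + F (S \<inter> T) \<le> F S + F T)"

lemma submodular_onD:
  "submodular_on M F \<Longrightarrow> S \<subseteq> M \<Longrightarrow> T \<subseteq> M \<Longrightarrow> F (S \<union> T) + F (S \<inter> T) \<le> F S + F T"
  by (simp add: submodular_on_def)

lemma mutual_info_extension:
  fixes P :: "('x, 'u) aia"
  assumes "aia_problem P"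
  obtains F where "\<And>S. S \<in> indep P \<Longrightarrow> mutual_info P S = F S"
    and "submodular_on (ground P) F" and "F {} = 0"
    and "\<And>S T. S \<subseteq> T \<Longrightarrow> T \<subseteq> ground P \<Longrightarrow> F S \<le> F T"
proof -
  have vr: "valid_robots P" and vs: "valid_sensors P"
    using assms by (auto simp: aia_problem_def)
  obtain m L where L: "\<And>t. L t \<in> carrier_mat (target_dim P) m"
    and mi: "\<And>S. S \<in> indep P \<Longrightarrow>
      mutual_info P S = 1/2 * ln (det (1\<^sub>m m + info_gram m L (joint_info P S) (horizon P)))"
    by (rule mutual_info_log_det[OF assms], rule that)
  define G where "G S = info_gram m L (joint_info P S) (horizon P)" for S
  define F where "F S = 1/2 * ln (det (1\<^sub>m m + G S))" for S
  have psd: "psd_mat m (G S)" if "S \<subseteq> ground P" for S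
    unfolding G_def using that by (intro info_gram_psd[where n = "target_dim P"] L joint_info_psd vr vs)
  note pos = det_one_plus_psd_pos[OF psd]
  have G_union: "G (S \<union> T) = G S + G T" if "S \<subseteq> ground P" "T \<subseteq> ground P" "S \<inter> T = {}" for S T
  proof -
    have "finite S" "finite T" using that finite_subset finite_ground[OF vr] by blast+
    then have "joint_info P (S \<union> T) = (\<lambda>t. joint_info P S t + joint_info P T t)"
      unfolding joint_info_def fun_eq_iff by (intro allI mat_sum_union that(3))
    moreover have "joint_info P R t \<in> carrier_mat (target_dim P) (target_dim P)" for R t
      by (simp add: joint_info_def)
    ultimately show ?thesis
      unfolding G_def using info_gram_add[where L = L and m = m and M = "joint_info P S" and M' = "joint_info P T", OF L]
      by simp
  qed
  have "mutual_info P S = F S" if "S \<in> indep P" for S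
    using mi[OF that] by (simp add: F_def G_def)
  moreover have "submodular_on (ground P) F"
    unfolding submodular_on_def
  proof (intro allI impI)
    fix S T assume ST: "S \<subseteq> ground P" "T \<subseteq> ground P"
    have sub: "S \<inter> T \<subseteq> ground P" "S - T \<subseteq> ground P" "T - S \<subseteq> ground P" "S \<union> T \<subseteq> ground P"
      using ST by auto
    have GS: "G S = G (S \<inter> T) + G (S - T)"
      using G_union[OF sub(1,2)] by (simp add: Int_Diff_Un Int_Diff_disjoint)
    have GT: "G T = G (S \<inter> T) + G (T - S)"
      using G_union[OF sub(1,3)] by (simp add: Int_commute[of S] Int_Diff_Un Int_Diff_disjoint)
    have "S \<union> T = S \<union> (T - S)" by blast
    then have GU: "G (S \<union> T) = G (S \<inter> T) + G (S - T) + G (T - S)"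
      using G_union[OF ST(1) sub(3)] GS by simp
    have "det (1\<^sub>m m + G (S \<union> T)) * det (1\<^sub>m m + G (S \<inter> T)) \<le> det (1\<^sub>m m + G S) * det (1\<^sub>m m + G T)"
      unfolding GU GS GT by (rule det_one_plus_psd_submodular[OF psd[OF sub(1)] psd[OF sub(2)] psd[OF sub(3)]])
    then have "ln (det (1\<^sub>m m + G (S \<union> T)) * det (1\<^sub>m m + G (S \<inter> T)))
        \<le> ln (det (1\<^sub>m m + G S) * det (1\<^sub>m m + G T))"
      using pos[OF sub(4)] pos[OF sub(1)] by (intro ln_mono) auto
    then show "F (S \<union> T) + F (S \<inter> T) \<le> F S + F T"
      using pos[OF sub(4)] pos[OF sub(1)] pos[OF ST(1)] pos[OF ST(2)] by (simp add: F_def ln_mult_pos)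
  qed
  moreover have "F {} = 0"
  proof -
    have "G {} = 0\<^sub>m m m"
    proof (rule eq_matI)
      fix i j assume "i < dim_row (0\<^sub>m m m :: real mat)" "j < dim_col (0\<^sub>m m m :: real mat)"
      moreover have "G {} = G {} + G {}" using G_union[of "{}" "{}"] by simp
      ultimately show "G {} $$ (i, j) = 0\<^sub>m m m $$ (i, j)"
        using psd_matD(1)[OF psd[of "{}"]] index_add_mat(1)[of i "G {}" j "G {}"] by simp
    qed (use psd_matD(1)[OF psd[of "{}"]] in auto)
    then show ?thesis by (simp add: F_def)
  qed
  moreover have "F S \<le> F T" if "S \<subseteq> T" "T \<subseteq> ground P" for S T
  proof -
    have sub: "S \<subseteq> ground P" "T - S \<subseteq> ground P" using that by auto
    have "S \<union> (T - S) = T" using that by blast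
    then have "G T = G S + G (T - S)" using G_union[OF sub] by simp
    then have "det (1\<^sub>m m + G S) \<le> det (1\<^sub>m m + G T)"
      using det_one_plus_psd_mono[OF psd[OF sub(1)] psd[OF sub(2)]] by simp
    then show ?thesis using pos[OF sub(1)] by (simp add: F_def)
  qed
  ultimately show thesis by (rule that)
qed

section \<open>Local search over a partition matroid\<close>

lemma submodular_add_family:
  assumes F: "submodular_on M F" and mono: "\<And>S T. S \<subseteq> T \<Longrightarrow> T \<subseteq> M \<Longrightarrow> F S \<le> F T"
    and "finite I" "S \<subseteq> M" "\<And>i. i \<in> I \<Longrightarrow> D i \<subseteq> M"
  shows "F (S \<union> (\<Union>i\<in>I. D i)) - F S \<le> (\<Sum>i\<in>I. F (S \<union> D i) - F S)"
  using assms(3,5)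
proof (induction I)
  case (insert i I)
  let ?A = "S \<union> (\<Union>i\<in>I. D i)" and ?B = "S \<union> D i"
  have sub: "?A \<subseteq> M" "?B \<subseteq> M" using insert.prems assms(4) by auto
  have "?A \<union> ?B = S \<union> (\<Union>i\<in>insert i I. D i)" by auto
  moreover have "F (?A \<union> ?B) + F (?A \<inter> ?B) \<le> F ?A + F ?B" by (rule submodular_onD[OF F sub])
  moreover have "F S \<le> F (?A \<inter> ?B)" using sub by (intro mono) auto
  ultimately show ?case using insert by simp
qed simp

lemma submodular_remove_family:
  assumes F: "submodular_on M F" and "finite I" "S \<subseteq> M" "disjoint_family_on D I"
  shows "(\<Sum>i\<in>I. F S - F (S - D i)) \<le> F S - F (S - (\<Union>i\<in>I. D i))"
  using assms(2,4)
proof (induction I)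
  case (insert i I)
  let ?A = "S - (\<Union>i\<in>I. D i)" and ?B = "S - D i"
  have "D i \<inter> (\<Union>i\<in>I. D i) = {}" using insert.prems insert.hyps by (auto simp: disjoint_family_on_def)
  then have "?A \<union> ?B = S" "?A \<inter> ?B = S - (\<Union>i\<in>insert i I. D i)" by auto
  moreover have "F (?A \<union> ?B) + F (?A \<inter> ?B) \<le> F ?A + F ?B"
    using assms(3) by (intro submodular_onD[OF F]) auto
  moreover have "(\<Sum>i\<in>I. F S - F (S - D i)) \<le> F S - F ?A"
    using insert by (auto simp: disjoint_family_on_def)
  ultimately show ?case using insert.hyps by simp
qed simp

definition exchange :: "('a \<Rightarrow> 'r) \<Rightarrow> 'a set \<Rightarrow> 'a set \<Rightarrow> 'r \<Rightarrow> 'a set" where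
  "exchange p C S i = (S - p -` {i}) \<union> (C \<inter> p -` {i})"

lemma exchange_inj_on:
  assumes "inj_on p S" "inj_on p C"
  shows "inj_on p (exchange p C S i)"
  using assms by (auto simp: exchange_def inj_on_def)

lemma inj_on_fibre:
  assumes "inj_on p S"
  shows "S \<inter> p -` {i} = {} \<or> (\<exists>a. S \<inter> p -` {i} = {a})"
proof (cases "S \<inter> p -` {i} = {}")
  case False
  then obtain a where a: "a \<in> S" "p a = i" by blast
  then have "b = a" if "b \<in> S \<inter> p -` {i}" for b using inj_onD[OF assms, of b a] that by simp
  then show ?thesis using a by blast
qed simp

lemma exchange_cases:
  assumes S: "inj_on p S" and C: "inj_on p C" "C \<subseteq> M"
  shows "exchange p C S i = S \<or> exchange p C S i \<in> ls_moves M S"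
proof -
  have eq: "exchange p C S i = (S - (S \<inter> p -` {i})) \<union> (C \<inter> p -` {i})" by (auto simp: exchange_def)
  consider (none) "C \<inter> p -` {i} = {}" | (one) a where "C \<inter> p -` {i} = {a}"
    using inj_on_fibre[OF C(1)] by blast
  then show ?thesis
  proof cases
    case none
    show ?thesis
    proof (cases "S \<inter> p -` {i} = {}")
      case True
      then show ?thesis unfolding eq none True by simp
    next
      case False
      then obtain d where d: "S \<inter> p -` {i} = {d}" using inj_on_fibre[OF S] by blast
      then have "d \<in> S" by blast
      then show ?thesis unfolding eq none d ls_moves_def by auto
    qed
  next
    case one
    then have a: "a \<in> M" "p a = i" using C(2) by auto
    show ?thesis
    proof (cases "S \<inter> p -` {i} = {}")
      case True
      then have "a \<in> M - S" using a by auto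
      then show ?thesis unfolding eq one True ls_moves_def by auto
    next
      case False
      then obtain d where d: "S \<inter> p -` {i} = {d}" using inj_on_fibre[OF S] by blast
      show ?thesis
      proof (cases "a = d")
        case True
        then show ?thesis unfolding eq one d using d by auto
      next
        case False
        then have "a \<in> M - S" "d \<in> S" using a d by auto
        then show ?thesis unfolding eq one d ls_moves_def by blast
      qed
    qed
  qed
qed

lemma local_optimum_bound:
  fixes F :: "'a set \<Rightarrow> real" and w :: "'a \<Rightarrow> real" and p :: "'a \<Rightarrow> 'r"
  assumes M: "finite M" and F: "submodular_on M F" and F0: "F {} = 0"
    and mono: "\<And>S T. S \<subseteq> T \<Longrightarrow> T \<subseteq> M \<Longrightarrow> F S \<le> F T"
    and K: "\<And>S. S \<subseteq> M \<Longrightarrow> inj_on p S \<Longrightarrow> sum w S \<le> K"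
    and S: "S \<subseteq> M" "inj_on p S" and C: "C \<subseteq> M" "inj_on p C" and \<epsilon>: "0 \<le> \<epsilon>"
    and opt: "\<And>S'. S' \<in> ls_moves M S \<Longrightarrow> S' \<subseteq> M \<Longrightarrow> inj_on p S' \<Longrightarrow>
      F S' - sum w S' + K \<le> (1 + \<epsilon>) * (F S - sum w S + K)"
  shows "F C - sum w C + K \<le> (2 + real (card (p ` M)) * \<epsilon>) * (F S - sum w S + K)"
proof -
  define g where "g S = F S - sum w S + K" for S
  define I where "I = p ` M"
  have I: "finite I" using M by (simp add: I_def)
  have fin: "finite S" "finite C" using S C M finite_subset by blast+
  have g_nonneg: "0 \<le> g S"
    using mono[of "{}" S] F0 K[OF S] S(1) by (simp add: g_def)
  let ?R = "\<lambda>i. p -` {i}"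
  have step: "F (S \<union> C \<inter> ?R i) - F S - (F S - F (S - ?R i)) + sum w (S \<inter> ?R i) - sum w (C \<inter> ?R i) \<le> \<epsilon> * g S"
    for i
  proof -
    let ?E = "exchange p C S i"
    have E: "?E \<subseteq> M" using S(1) C(1) by (auto simp: exchange_def)
    have "?E \<union> S = S \<union> C \<inter> ?R i" by (auto simp: exchange_def)
    moreover have "F (S - ?R i) \<le> F (?E \<inter> S)" using S(1) by (intro mono) (auto simp: exchange_def)
    moreover have "F (?E \<union> S) + F (?E \<inter> S) \<le> F ?E + F S" by (rule submodular_onD[OF F E S(1)])
    moreover have "sum w ?E = sum w S - sum w (S \<inter> ?R i) + sum w (C \<inter> ?R i)"
    proof -
      have "sum w ?E = sum w (S - ?R i) + sum w (C \<inter> ?R i)"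
        unfolding exchange_def using fin by (intro sum.union_disjoint) auto
      moreover have "sum w S = sum w (S \<inter> ?R i) + sum w (S - ?R i)"
        by (rule sum.Int_Diff[OF fin(1)])
      ultimately show ?thesis by simp
    qed
    moreover have "g ?E \<le> (1 + \<epsilon>) * g S"
    proof (cases "?E = S")
      case True
      have "1 * g S \<le> (1 + \<epsilon>) * g S" using g_nonneg \<epsilon> by (intro mult_right_mono) auto
      then show ?thesis using True by simp
    next
      case False
      then have "?E \<in> ls_moves M S" using exchange_cases[OF S(2) C(2,1)] by blast
      then show ?thesis using opt[OF _ E exchange_inj_on[OF S(2) C(2)]] by (simp add: g_def)
    qed
    ultimately show ?thesis by (simp add: g_def algebra_simps)
  qed
  have fibres: "(\<Sum>i\<in>I. sum w (T \<inter> ?R i)) = sum w T" if "T \<subseteq> M" for T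
  proof -
    have "T \<inter> ?R i = {x \<in> T. p x = i}" for i by auto
    then show ?thesis
      using sum.group[of T I p w] that I finite_subset[OF that M] by (auto simp: I_def)
  qed
  have "F (S \<union> (\<Union>i\<in>I. C \<inter> ?R i)) - F S \<le> (\<Sum>i\<in>I. F (S \<union> C \<inter> ?R i) - F S)"
    using C(1) S(1) I mono by (intro submodular_add_family[OF F]) auto
  moreover have "(\<Union>i\<in>I. C \<inter> ?R i) = C" using C(1) by (auto simp: I_def)
  moreover have "F C \<le> F (S \<union> C)" using S(1) C(1) by (intro mono) auto
  moreover have "(\<Sum>i\<in>I. F S - F (S - ?R i)) \<le> F S - F (S - (\<Union>i\<in>I. ?R i))"
    using S(1) I by (intro submodular_remove_family[OF F]) (auto simp: disjoint_family_on_def)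
  moreover have "S - (\<Union>i\<in>I. ?R i) = {}" using S(1) by (auto simp: I_def)
  moreover have "(\<Sum>i\<in>I. F (S \<union> C \<inter> ?R i) - F S - (F S - F (S - ?R i)) + sum w (S \<inter> ?R i) - sum w (C \<inter> ?R i))
      \<le> (\<Sum>i\<in>I. \<epsilon> * g S)"
    by (intro sum_mono step)
  then have "(\<Sum>i\<in>I. F (S \<union> C \<inter> ?R i) - F S) - (\<Sum>i\<in>I. F S - F (S - ?R i)) + sum w S - sum w C
      \<le> real (card I) * (\<epsilon> * g S)"
    by (simp add: sum.distrib sum_subtractf fibres[OF S(1)] fibres[OF C(1)] algebra_simps)
  ultimately have "F C - sum w C \<le> 2 * F S - sum w S + real (card I) * (\<epsilon> * g S)"
    using F0 by simp
  moreover have "2 * F S - sum w S + K \<le> 2 * g S" using K[OF S] by (simp add: g_def)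
  ultimately have "F C - sum w C + K \<le> 2 * g S + real (card I) * (\<epsilon> * g S)" by linarith
  also have "\<dots> = (2 + real (card I) * \<epsilon>) * g S" by (simp add: algebra_simps)
  finally show ?thesis by (simp only: g_def I_def)
qed

lemma energy_cost_le_offset:
  assumes "valid_robots P" "valid_energy P" "S \<in> indep P"
  shows "energy_cost P S \<le> offset P"
proof -
  have inj: "inj_on fst S" and S: "S \<subseteq> ground P"
    using assms indep_iff_inj_on_fst by auto
  have "energy_cost P S \<le> (\<Sum>e\<in>S. cost_weight P (fst e) * energy_max P)"
    unfolding energy_cost_def case_prod_beta
    using S assms(2) by (intro sum_mono mult_left_mono) (auto simp: ground_def robot_trajs_def valid_energy_def)
  also have "\<dots> = (\<Sum>i\<in>fst ` S. cost_weight P i * energy_max P)"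
    by (simp add: sum.reindex[OF inj])
  also have "\<dots> \<le> offset P"
    unfolding offset_def using S assms(2)
    by (intro sum_mono2) (auto simp: robots_def ground_def robot_trajs_def valid_energy_def)
  finally show ?thesis .
qed

lemma ls_result_indep:
  assumes "ls_result \<alpha> N (indep P) g (ground P) S" and vr: "valid_robots P"
  shows "S \<in> indep P"
proof -
  obtain S0 where S0: "ls_init g (ground P) S0" and "(ls_step \<alpha> N (indep P) g (ground P))\<^sup>*\<^sup>* S0 S"
    using assms by (auto simp: ls_result_def)
  from this(2) show ?thesis
  proof (induction rule: rtranclp_induct)
    case base
    show ?case
      using S0 unfolding indep_iff_inj_on_fst[OF vr]
      by (auto simp: ls_init_def is_arg_max_def split: if_splits)
  qed (simp add: ls_step_def)
qed

theorem proposition1: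
  fixes P :: "('x, 'u) aia"
    and \<alpha> :: real
    and Sopt Sls :: "(nat \<times> 'u list) set"
  assumes "aia_problem P"
    and "\<alpha> > 0"
    and "is_arg_max (offset_objective P) (\<lambda>S. S \<in> indep P) Sopt"
    and "cls_output \<alpha> (ground P) (indep P) (offset_objective P) Sls"
  shows "0 \<le> offset_objective P Sopt
       \<and> offset_objective P Sopt \<le> 4 * (1 + \<alpha>) * offset_objective P Sls"
proof -
  let ?g = "offset_objective P" and ?M = "ground P"
  have vr: "valid_robots P" and ve: "valid_energy P" using assms(1) by (auto simp: aia_problem_def)
  note indep = indep_iff_inj_on_fst[OF vr]
  note fin = finite_ground[OF vr]
  obtain F where F: "\<And>S. S \<in> indep P \<Longrightarrow> mutual_info P S = F S"
    "submodular_on ?M F" "F {} = 0" "\<And>S T. S \<subseteq> T \<Longrightarrow> T \<subseteq> ?M \<Longrightarrow> F S \<le> F T"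
    by (rule mutual_info_extension[OF assms(1)], rule that)
  define w where "w = (\<lambda>(i, \<sigma>). cost_weight P i * energy P i \<sigma>)"
  have cost: "energy_cost P S = sum w S" for S
    by (simp add: energy_cost_def w_def)
  have g: "?g S = F S - sum w S + offset P" if "S \<in> indep P" for S
    using F(1)[OF that] by (simp add: offset_objective_def objective_def cost)
  have cost_le: "sum w S \<le> offset P" if "S \<subseteq> ?M" "inj_on fst S" for S
    using energy_cost_le_offset[OF vr ve] indep that cost by simp
  have nonneg: "0 \<le> ?g S" if "S \<in> indep P" for S
    using g[OF that] cost_le[of S] F(3) F(4)[of "{}" S] that indep by simp
  have opt: "Sopt \<in> indep P" using assms(3) by (simp add: is_arg_max_def)
  obtain S1 where S1: "ls_result \<alpha> (card ?M) (indep P) ?g ?M S1" and ge: "?g S1 \<le> ?g Sls"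
    using assms(4) unfolding cls_output_def by (metis max.cobounded1)
  have S1_indep: "S1 \<in> indep P" by (rule ls_result_indep[OF S1 vr])
  define \<epsilon> where "\<epsilon> = \<alpha> / real (card ?M) ^ 4"
  have \<epsilon>: "0 \<le> \<epsilon>" using assms(2) by (simp add: \<epsilon>_def)
  have "?g S' \<le> (1 + \<epsilon>) * ?g S1" if "S' \<in> ls_moves ?M S1" "S' \<in> indep P" for S'
    using S1 that by (force simp: ls_result_def ls_step_def \<epsilon>_def not_le)
  then have "?g Sopt \<le> (2 + real (card (fst ` ?M)) * \<epsilon>) * ?g S1"
    using local_optimum_bound[of ?M F fst w "offset P" S1 Sopt \<epsilon>, OF fin F(2-4) cost_le]
      S1_indep opt indep \<epsilon> g by simp
  also have "\<dots> \<le> 4 * (1 + \<alpha>) * ?g S1"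
  proof (rule mult_right_mono[OF _ nonneg[OF S1_indep]])
    have "real (card (fst ` ?M)) \<le> real (card ?M) ^ 4"
    proof (cases "card ?M = 0")
      case True
      then show ?thesis using card_image_le[OF fin, of fst] by simp
    next
      case False
      then have "real (card ?M) \<le> real (card ?M) ^ 4"
        using power_increasing[of 1 4 "real (card ?M)"] by simp
      then show ?thesis using card_image_le[OF fin, of fst] by simp
    qed
    then have "real (card (fst ` ?M)) * \<epsilon> \<le> real (card ?M) ^ 4 * \<epsilon>"
      using \<epsilon> by (rule mult_right_mono)
    also have "\<dots> \<le> \<alpha>" using assms(2) by (simp add: \<epsilon>_def)
    finally show "2 + real (card (fst ` ?M)) * \<epsilon> \<le> 4 * (1 + \<alpha>)" using assms(2) by simp
  qed
  also have "\<dots> \<le> 4 * (1 + \<alpha>) * ?g Sls" using ge assms(2) by simp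
  finally show ?thesis using nonneg[OF opt] by simp
qed

end
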